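(* Let $a_1>a_2$, $b_1>b_2$, $N>0$, $t\in(0,1)$, and let $w_{1,k}(x)=e^{-\frac{N}{2t}(x^2-2a_kx)}$ ($k=1,2$), $w_{2,l}(x)=e^{-\frac{N}{2(1-t)}(x^2-2b_lx)}$ ($l=1,2$). Let $\mathbf n=(n_1,n_2)$, $\mathbf m=(m_1,m_2)$ be pairs of positive integers with $n_1+n_2=m_1+m_2$, and let $c_{i,j}$, $1\le i,j\le4$, be the entries of the matrix $(Y_1)_{\mathbf n,\mathbf m}$ defined in the context. Then the multiple Hermite polynomials (polynomials in $z$) satisfy the recurrence relations $$(A_1)^{(II,1)}_{\mathbf n+2\mathbf e_1,\mathbf m+\mathbf e_1}=\Big(z-(1-t)a_1-tb_1+\tfrac{c_{1,2}c_{2,3}}{c_{1,3}}\Big)(A_1)^{(II,1)}_{\mathbf n+\mathbf e_1,\mathbf m}-c_{1,2}c_{2,1}(A_1)^{(II,1)}_{\mathbf n+\mathbf e_2,\mathbf m}-c_{1,3}c_{3,1}(A_1)^{(II,1)}_{\mathbf n,\mathbf m-\mathbf e_1}-c_{1,4}c_{4,1}(A_1)^{(II,1)}_{\mathbf n,\mathbf m-\mathbf e_2},$$ $$(A_1)^{(II,1)}_{\mathbf n+2\mathbf e_1,\mathbf m+\mathbf e_2}=\Big(z-(1-t)a_1-tb_2+\tfrac{c_{1,2}c_{2,4}}{c_{1,4}}\Big)(A_1)^{(II,1)}_{\mathbf n+\mathbf e_1,\mathbf m}-c_{1,2}c_{2,1}(A_1)^{(II,1)}_{\mathbf n+\mathbf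 e_2,\mathbf m}-c_{1,3}c_{3,1}(A_1)^{(II,1)}_{\mathbf n,\mathbf m-\mathbf e_1}-c_{1,4}c_{4,1}(A_1)^{(II,1)}_{\mathbf n,\mathbf m-\mathbf e_2},$$ $$(A_2)^{(II,2)}_{\mathbf n+2\mathbf e_2,\mathbf m+\mathbf e_1}=\Big(z-(1-t)a_2-tb_1+\tfrac{c_{2,1}c_{1,3}}{c_{2,3}}\Big)(A_2)^{(II,2)}_{\mathbf n+\mathbf e_2,\mathbf m}-c_{2,1}c_{1,2}(A_2)^{(II,2)}_{\mathbf n+\mathbf e_1,\mathbf m}-c_{2,3}c_{3,2}(A_2)^{(II,2)}_{\mathbf n,\mathbf m-\mathbf e_1}-c_{2,4}c_{4,2}(A_2)^{(II,2)}_{\mathbf n,\mathbf m-\mathbf e_2},$$ $$(A_2)^{(II,2)}_{\mathbf n+2\mathbf e_2,\mathbf m+\mathbf e_2}=\Big(z-(1-t)a_2-tb_2+\tfrac{c_{2,1}c_{1,4}}{c_{2,4}}\Big)(A_2)^{(II,2)}_{\mathbf n+\mathbf e_2,\mathbf m}-c_{2,1}c_{1,2}(A_2)^{(II,2)}_{\mathbf n+\mathbf e_1,\mathbf m}-c_{2,3}c_{3,2}(A_2)^{(II,2)}_{\mathbf n,\mathbf m-\mathbf e_1}-c_{2,4}c_{4,2}(A_2)^{(II,2)}_{\mathbf n,\mathbf m-\mathbf e_2}.$$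
   Context: Multiple orthogonal polynomials (MOP). For multi-indices $\boldsymbol\nu=(\nu_1,\nu_2)$, $\boldsymbol\mu=(\mu_1,\mu_2)$ of nonnegative integers with $\nu_1+\nu_2=\mu_1+\mu_2+1$, a (nonzero) vector of polynomials $(A_1,A_2)$ is multiple orthogonal if $\deg A_k\le\nu_k-1$ for $k=1,2$ and $Q(x)=A_1(x)w_{1,1}(x)+A_2(x)w_{1,2}(x)$ satisfies $\int_{-\infty}^\infty Q(x)x^jw_{2,l}(x)\,dx=0$ for $j=0,\dots,\mu_l-1$, $l=1,2$. The vector with the type $(II,k)$ normalization, i.e. $A_k(x)=x^{\nu_k-1}+O(x^{\nu_k-2})$, is denoted $\big((A_1)^{(II,k)}_{\boldsymbol\nu,\boldsymbol\mu},(A_2)^{(II,k)}_{\boldsymbol\nu,\boldsymbol\mu}\big)$. For the Gaussian weights above these are called multiple Hermite polynomials, and the MOP and all the normalizations occurring exist. $\mathbf e_1=(1,0)$, $\mathbf e_2=(0,1)$. The matrix $Y_1$. For $\mathbf n,\mathbf m$ with $n_1+n_2=m_1+m_2$, $Y=Y_{\mathbf n,\mathbf m}$ is the unique $4\times4$ matrix-valued function (known to exist for these weights) with: (1) $Y$ analytic in $\mathbb C\setminus\mathbb R$; (2) $Y_+(x)=Y_-(x)\begin{pmatrix}I_2&W(x)\\0&I_2\end{pmatrix}$ for $x\in\mathbb R$, where $W(x)=\big(w_{1,k}(x)w_{2,l}(x)\big)_{k,l=1}^2$ and $Y_\pm$ are limiting values from the upper/lower half plane; (3) $Y(z)=\left(I+\frac{Y_1}{z}+O(z^{-2})\right)\mathrm{diag}(z^{n_1},z^{n_2},z^{-m_1},z^{-m_2})$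 as $z\to\infty$, which defines the constant matrix $Y_1=(Y_1)_{\mathbf n,\mathbf m}$. *)

theory Defs
  imports
    "HOL-Complex_Analysis.Complex_Analysis"
    "HOL-Library.Landau_Symbols"
begin

text \<open>\<open>$\<close> is vector indexing throughout, not the coefficient of a formal power series.\<close>

no_notation fps_nth (infixl \<open>$\<close> 75)

text \<open>
  Pairs (of weight parameters, multi-indices, polynomials) are vectors over the index type \<^typ>\<open>2\<close>,
  so index \<open>k\<close> of the mathematics is component \<open>$ k\<close>.
\<close>

abbreviation e\<^sub>1 :: "nat ^ 2" where "e\<^sub>1 \<equiv> axis 1 1"
abbreviation e\<^sub>2 :: "nat ^ 2" where "e\<^sub>2 \<equiv> axis 2 1"

definition w1 :: "real \<Rightarrow> real \<Rightarrow> real ^ 2 \<Rightarrow> 2 \<Rightarrow> real \<Rightarrow> real" where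
  "w1 N t a k x = exp (- (N / (2 * t)) * (x^2 - 2 * a $ k * x))"

definition w2 :: "real \<Rightarrow> real \<Rightarrow> real ^ 2 \<Rightarrow> 2 \<Rightarrow> real \<Rightarrow> real" where
  "w2 N t b l x = exp (- (N / (2 * (1 - t))) * (x^2 - 2 * b $ l * x))"

definition mop_Q :: "real \<Rightarrow> real \<Rightarrow> real ^ 2 \<Rightarrow> complex poly ^ 2 \<Rightarrow> real \<Rightarrow> complex" where
  "mop_Q N t a A x =
     poly (A $ 1) (of_real x) * of_real (w1 N t a 1 x) + poly (A $ 2) (of_real x) * of_real (w1 N t a 2 x)"

text \<open>
  The bound \<open>deg A\<^sub>k \<le> \<nu>\<^sub>k - 1\<close> means \<open>A\<^sub>k = 0\<close> when \<open>\<nu>\<^sub>k = 0\<close>. For \<open>N > 0\<close> and \<open>0 < t < 1\<close> all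
  integrands below are integrable, so no integral is zero for the trivial reason that it does not exist.
\<close>

definition is_mop ::
  "real \<Rightarrow> real \<Rightarrow> real ^ 2 \<Rightarrow> real ^ 2 \<Rightarrow> nat ^ 2 \<Rightarrow> nat ^ 2 \<Rightarrow> complex poly ^ 2 \<Rightarrow> bool" where
  "is_mop N t a b \<nu> \<mu> A \<longleftrightarrow>
     \<nu> $ 1 + \<nu> $ 2 = \<mu> $ 1 + \<mu> $ 2 + 1 \<and>
     A \<noteq> 0 \<and>
     (\<forall>k. A $ k = 0 \<or> degree (A $ k) < \<nu> $ k) \<and>
     (\<forall>l. \<forall>j < \<mu> $ l.
        (\<integral>x. mop_Q N t a A x * of_real (x ^ j) * of_real (w2 N t b l x) \<partial>lborel) = 0)"

definition mop_II ::
  "real \<Rightarrow> real \<Rightarrow> real ^ 2 \<Rightarrow> real ^ 2 \<Rightarrow> 2 \<Rightarrow> nat ^ 2 \<Rightarrow> nat ^ 2 \<Rightarrow> complex poly ^ 2" where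
  "mop_II N t a b k \<nu> \<mu> =
     (THE A. is_mop N t a b \<nu> \<mu> A \<and> degree (A $ k) + 1 = \<nu> $ k \<and> lead_coeff (A $ k) = 1)"

definition jump :: "real \<Rightarrow> real \<Rightarrow> real ^ 2 \<Rightarrow> real ^ 2 \<Rightarrow> real \<Rightarrow> complex ^ 4 ^ 4" where
  "jump N t a b x =
     (let W = (\<lambda>k l. complex_of_real (w1 N t a k x * w2 N t b l x)) in
      vector [vector [1, 0, W 1 1, W 1 2],
              vector [0, 1, W 2 1, W 2 2],
              vector [0, 0, 1, 0],
              vector [0, 0, 0, 1]])"

definition asymp_diag :: "nat ^ 2 \<Rightarrow> nat ^ 2 \<Rightarrow> complex \<Rightarrow> complex ^ 4 ^ 4" where
  "asymp_diag n m z =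
     (let d = vector [z ^ n $ 1, z ^ n $ 2, z powi - int (m $ 1), z powi - int (m $ 2)] :: complex ^ 4
      in \<chi> i j. if i = j then d $ i else 0)"

text \<open>
  The boundary values are unrestricted limits within the open half planes, and the expansion at
  infinity is uniform over all directions in \<open>- \<real>\<close>. The last argument is the coefficient \<open>Y\<^sub>1\<close>.
\<close>

definition is_RHP_solution ::
  "real \<Rightarrow> real \<Rightarrow> real ^ 2 \<Rightarrow> real ^ 2 \<Rightarrow> nat ^ 2 \<Rightarrow> nat ^ 2 \<Rightarrow>
   (complex \<Rightarrow> complex ^ 4 ^ 4) \<Rightarrow> complex ^ 4 ^ 4 \<Rightarrow> bool" where
  "is_RHP_solution N t a b n m Y Y1 \<longleftrightarrow>
     (\<forall>i j. (\<lambda>z. Y z $ i $ j) analytic_on - \<real>) \<and>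
     (\<forall>x :: real. \<exists>Yp Ym.
        (Y \<longlongrightarrow> Yp) (at (of_real x) within {z. Im z > 0}) \<and>
        (Y \<longlongrightarrow> Ym) (at (of_real x) within {z. Im z < 0}) \<and>
        Yp = Ym ** jump N t a b x) \<and>
     (\<exists>E.
        (\<forall>i j. (\<lambda>z. E z $ i $ j) \<in> O[inf at_infinity (principal (- \<real>))](\<lambda>z. 1 / z^2)) \<and>
        (\<forall>z \<in> - \<real>. Y z = (mat 1 + (\<chi> i j. Y1 $ i $ j / z) + E z) ** asymp_diag n m z))"

end

theory Submission
  imports Defs "HOL-Probability.Distributions" "HOL-Real_Asymp.Real_Asymp"
begin

no_notation fps_nth (infixl \<open>$\<close> 75)

text \<open>
  Write \<open>\<langle>A, r\<rangle>\<^sub>l\<close> for the integral of \<open>(A\<^sub>1 w\<^sub>1\<^sub>1 + A\<^sub>2 w\<^sub>1\<^sub>2) r w\<^sub>2\<^sub>l\<close> over the real line, and put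
  \<open>\<kappa> = N / (t (1 - t))\<close> and \<open>s\<^sub>k\<^sub>l = (1 - t) a\<^sub>k + t b\<^sub>l\<close>. Then \<open>w\<^sub>1\<^sub>k w\<^sub>2\<^sub>l\<close> is the Gaussian
  \<open>exp (- \<kappa> x\<^sup>2 / 2 + \<kappa> s\<^sub>k\<^sub>l x)\<close>, so every orthogonality condition is a statement about the functionals
  \<open>p \<mapsto> \<integral> p(x) exp (- \<kappa> x\<^sup>2 / 2 + \<kappa> s x) dx\<close>. The proof combines three facts.

  \<^item> \<^emph>\<open>Reading the matrix \<open>Y\<close>\<close> (\<open>RHP_row_pairings\<close>). The first two columns of \<open>Y\<close> do not jump across the real
  line and grow polynomially, so they are polynomials by Liouville. The jump of the other two columns
  is \<open>Q w\<^sub>2\<^sub>l\<close>, where \<open>Q\<close> is formed from the polynomials in the same row. Pushing the contour to infinity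
  turns \<open>\<integral> Q(x) x\<^sup>j w\<^sub>2\<^sub>l(x) dx\<close> into a coefficient of the expansion at infinity. Hence the rows of \<open>Y\<close> are,
  up to constants, multiple orthogonal for the indices \<open>(n + e\<^sub>1, m)\<close>, \<open>(n + e\<^sub>2, m)\<close>, \<open>(n, m - e\<^sub>1)\<close>,
  \<open>(n, m - e\<^sub>2)\<close>, and the entries of \<open>Y\<^sub>1\<close> are their subleading coefficients and first nonvanishing
  moments.

  \<^item> \<^emph>\<open>Every index is normal\<close> (\<open>orthogonal_eq_0\<close>): a polynomial pair that has no more free coefficients than
  it satisfies orthogonality conditions is zero. Integrating against a Gaussian
  acts as the heat flow on polynomials and turns the conditions against \<open>w\<^sub>2\<^sub>l\<close> into the vanishing to order
  \<open>\<mu>\<^sub>l\<close> at \<open>\<beta> = t b\<^sub>l\<close> of an exponential polynomial in \<open>\<beta>\<close>. By Rolle, such a function, unless it is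
  zero, has fewer real zeros, counted with multiplicity, than coefficients. Normality gives uniqueness of the normalized vectors and
  shows that the entries of \<open>Y\<^sub>1\<close> that are divided by do not vanish.

  \<^item> \<^emph>\<open>A first-order identity special to Gaussians\<close>. Let \<open>U\<close> be row \<open>k\<close> and let
  \<open>D U = (U\<^sub>j' / \<kappa> + (1 - t) (a\<^sub>j - a\<^sub>k) U\<^sub>j)\<^sub>j\<close>. Integration by parts gives
  \<open>\<langle>D U, x\<^sup>i\<rangle>\<^sub>l = \<langle>U, (x - s\<^sub>k\<^sub>l) x\<^sup>i\<rangle>\<^sub>l - (i / \<kappa>) \<langle>U, x\<^sup>i\<^sup>-\<^sup>1\<rangle>\<^sub>l\<close> for both \<open>l\<close> at once, because
  \<open>s\<^sub>j\<^sub>l - s\<^sub>k\<^sub>l\<close> is independent of \<open>l\<close>. Normality then identifies \<open>D U\<close> with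
  \<open>c\<^sub>k\<^sub>3\<close> times row 3 plus \<open>c\<^sub>k\<^sub>4\<close> times row 4. This is what produces the explicit
  constant \<open>- s\<^sub>k\<^sub>l\<close> in the recurrence: with \<open>g\<close> the constant that is added to \<open>z\<close> there, the vector
  \<open>(z + g) U - c\<^sub>k\<^sub>k\<^sub>' U' - D U\<close>, with \<open>U'\<close> the
  row \<open>k'\<close> of the other weight, pairs with \<open>x\<^sup>i\<close> to
  \<open>(g + s\<^sub>k\<^sub>l) \<langle>U, x\<^sup>i\<rangle>\<^sub>l - c\<^sub>k\<^sub>k\<^sub>' \<langle>U', x\<^sup>i\<rangle>\<^sub>l + (i / \<kappa>) \<langle>U, x\<^sup>i\<^sup>-\<^sup>1\<rangle>\<^sub>l\<close>, and \<open>g\<close> is chosen to make the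
  case \<open>i = m\<^sub>l\<close> vanish.
\<close>

section \<open>Real zeros of exponential polynomials\<close>

lemma Rolle_between_zeros:
  fixes f g :: "real \<Rightarrow> real"
  assumes deriv: "\<And>x. (f has_real_derivative g x) (at x)"
    and "finite S" "S \<noteq> {}" "\<forall>x\<in>S. f x = 0"
  shows "\<exists>T. finite T \<and> card T + 1 = card S \<and> T \<inter> S = {} \<and> (\<forall>x\<in>T. x < Max S) \<and> (\<forall>x\<in>T. g x = 0)"
  using assms(2-)
proof (induction S rule: finite_linorder_max_induct)
  case empty
  then show ?case by simp
next
  case (insert b S)
  show ?case
  proof (cases "S = {}")
    case True
    then show ?thesis by (intro exI[of _ "{}"]) auto
  next
    case False
    then obtain T where T: "finite T" "card T + 1 = card S" "T \<inter> S = {}"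
      "\<forall>x\<in>T. x < Max S" "\<forall>x\<in>T. g x = 0"
      using insert by auto
    have lt: "Max S < b" and mem: "Max S \<in> S" using insert False by auto
    have "\<exists>z. Max S < z \<and> z < b \<and> DERIV f z :> 0"
      using lt mem insert.prems False deriv
      by (intro Rolle) (auto simp: real_differentiable_def intro!: DERIV_continuous_on
            intro: has_field_derivative_at_within)
    then obtain z where z: "Max S < z" "z < b" "DERIV f z :> 0" by blast
    have gz: "g z = 0" using z(3) deriv DERIV_unique by blast
    have zS: "z \<notin> S" using z(1) insert(1) by (meson Max_ge leD)
    have zT: "z \<notin> T" using T(4) z(1) by auto
    have bT: "b \<notin> T" using T(4) lt by auto
    have bS: "b \<notin> S" using insert.hyps by auto
    have mx: "Max (insert b S) = b" using insert.hyps by (intro Max_eqI) (auto intro: less_imp_le)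
    show ?thesis
      using T z gz zS zT bT bS mx insert.hyps lt by (intro exI[of _ "insert z T"]) auto
  qed
qed

text \<open>
  The argument \<open>f\<close> stands for the jet \<open>f 0, f 1, \<dots>\<close> of a function and its successive derivatives, so
  \<open>\<mu> x\<close> is a lower bound for the order of vanishing at \<open>x\<close>.
\<close>
definition zeros_at_least :: "(nat \<Rightarrow> real \<Rightarrow> real) \<Rightarrow> nat \<Rightarrow> bool" where
  "zeros_at_least f K \<longleftrightarrow>
     (\<exists>S \<mu>. finite S \<and> (\<forall>x\<in>S. \<forall>j < \<mu> x. f j x = 0) \<and> (\<Sum>x\<in>S. \<mu> x) = K)"

text \<open>
  A zero of order \<open>\<mu>\<close> loses one order under differentiation, and Rolle supplies a new zero in each
  of the gaps between the distinct zeros, so at most one zero is lost in total.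
\<close>
lemma zeros_at_least_deriv:
  assumes deriv: "\<And>j x. (f j has_real_derivative f (Suc j) x) (at x)"
    and "zeros_at_least f (Suc K)"
  shows "zeros_at_least (\<lambda>j. f (Suc j)) K"
proof -
  obtain S0 \<mu> where S0: "finite S0" "\<forall>x\<in>S0. \<forall>j < \<mu> x. f j x = 0" "(\<Sum>x\<in>S0. \<mu> x) = Suc K"
    using assms(2) by (auto simp: zeros_at_least_def)
  define S where "S = {x\<in>S0. \<mu> x > 0}"
  have S: "finite S" "\<forall>x\<in>S. \<forall>j < \<mu> x. f j x = 0" "\<forall>x\<in>S. \<mu> x > 0"
    using S0 by (auto simp: S_def)
  have sumS: "(\<Sum>x\<in>S. \<mu> x) = Suc K"
    unfolding S0(3)[symmetric] S_def using S0(1) by (intro sum.mono_neutral_left) auto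
  hence "S \<noteq> {}" by auto
  then obtain T where T: "finite T" "card T + 1 = card S" "T \<inter> S = {}" "\<forall>x\<in>T. f (Suc 0) x = 0"
    using Rolle_between_zeros[of "f 0" "f (Suc 0)" S] deriv S by auto
  define \<mu>' where "\<mu>' = (\<lambda>x. if x \<in> S then \<mu> x - 1 else 1)"
  have "(\<Sum>x\<in>S. \<mu> x) = (\<Sum>x\<in>S. \<mu>' x + 1)"
    using S(3) by (intro sum.cong) (auto simp: \<mu>'_def)
  also have "\<dots> = (\<Sum>x\<in>S. \<mu>' x) + card S" by (simp only: sum.distrib card_eq_sum)
  finally have 1: "(\<Sum>x\<in>S. \<mu>' x) + card S = Suc K" using sumS by simp
  have 2: "(\<Sum>x\<in>T. \<mu>' x) = card T"
    using T(3) by (subst card_eq_sum) (intro sum.cong, auto simp: \<mu>'_def)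
  have "(\<Sum>x\<in>S \<union> T. \<mu>' x) = K"
    using 1 2 T S(1) by (subst sum.union_disjoint) auto
  moreover have "\<forall>x\<in>S \<union> T. \<forall>j < \<mu>' x. f (Suc j) x = 0"
    using S T by (auto simp: \<mu>'_def)
  ultimately show ?thesis
    unfolding zeros_at_least_def using S(1) T(1) by (intro exI[of _ "S \<union> T"] exI[of _ \<mu>']) auto
qed

lemma zeros_at_least_iterated_deriv:
  assumes "\<And>j x. (f j has_real_derivative f (Suc j) x) (at x)"
    and "zeros_at_least f (d + K)"
  shows "zeros_at_least (\<lambda>j. f (d + j)) K"
  using assms
proof (induction d arbitrary: f)
  case (Suc d)
  have "zeros_at_least (\<lambda>j. f (Suc j)) (d + K)"
    using zeros_at_least_deriv[of f "d + K"] Suc.prems by simp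
  from Suc.IH[OF _ this] Suc.prems(1) show ?case by simp
qed simp

text \<open>Differentiation conjugated by the exponential: \<open>(e\<^sup>c\<^sup>x p)' = e\<^sup>c\<^sup>x \<cdot> exp_deriv c p\<close>.\<close>
definition exp_deriv :: "'a \<Rightarrow> 'a poly \<Rightarrow> 'a::field_char_0 poly" where
  "exp_deriv c p = pderiv p + smult c p"

lemma exp_deriv_0 [simp]: "exp_deriv 0 = pderiv"
  by (simp add: exp_deriv_def fun_eq_iff)

lemma has_real_derivative_exp_mult_poly:
  "((\<lambda>x. exp (c * x) * poly p x) has_real_derivative exp (c * x) * poly (exp_deriv c p) x) (at x)"
  by (auto intro!: derivative_eq_intros simp: exp_deriv_def algebra_simps)

lemma degree_iterated_exp_deriv_le: "degree ((exp_deriv c ^^ j) p) \<le> degree p"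
proof (induction j)
  case (Suc j)
  have "degree (exp_deriv c q) \<le> degree q" for q
    unfolding exp_deriv_def
    by (intro degree_add_le) (simp_all add: degree_pderiv degree_smult_le)
  with Suc show ?case by (auto intro: le_trans)
qed simp

lemma exp_deriv_eq_0:
  assumes "c \<noteq> 0" "exp_deriv c p = 0"
  shows "p = 0"
proof -
  have "coeff (exp_deriv c p) (degree p) = c * lead_coeff p"
    by (simp add: exp_deriv_def coeff_pderiv coeff_eq_0)
  with assms show ?thesis by simp
qed

lemma iterated_exp_deriv_eq_0:
  assumes "c \<noteq> 0" "(exp_deriv c ^^ j) p = 0"
  shows "p = 0"
  using assms(2) by (induction j) (auto dest: exp_deriv_eq_0[OF assms(1)])

lemma iterated_pderiv_eq_0_if_degree_less:
  assumes "degree p < d \<or> p = 0"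
  shows "(pderiv ^^ d) p = (0 :: 'a::field_char_0 poly)"
  using assms
proof (induction d arbitrary: p)
  case (Suc d)
  have "(pderiv ^^ d) (pderiv p) = 0"
  proof (rule Suc.IH)
    show "degree (pderiv p) < d \<or> pderiv p = 0"
      using Suc.prems by (cases "degree p = 0") (auto simp: degree_pderiv pderiv_eq_0_iff)
  qed
  then show ?case by (simp add: funpow_swap1)
qed auto

text \<open>
  Multiplication by \<open>e\<^sup>c\<^sup>x\<close> does not change orders of vanishing. Since \<open>pderiv\<close> and \<open>exp_deriv c\<close>
  differ by a multiple of the identity, this is an induction on the order without the Leibniz rule.
\<close>
lemma vanishing_order_exp_deriv:
  assumes "\<forall>j<M. poly ((exp_deriv c ^^ j) p) x = 0"
  shows "\<forall>j<M. poly ((pderiv ^^ j) p) x = 0"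
  using assms
proof (induction M arbitrary: p)
  case (Suc M)
  have "\<forall>j<M. poly ((exp_deriv c ^^ j) (exp_deriv c p)) x = 0"
  proof (intro allI impI)
    fix j assume "j < M"
    with Suc.prems have "poly ((exp_deriv c ^^ Suc j) p) x = 0" by (meson Suc_less_eq)
    then show "poly ((exp_deriv c ^^ j) (exp_deriv c p)) x = 0" by (simp add: funpow_swap1)
  qed
  hence *: "\<forall>j<M. poly ((pderiv ^^ j) (exp_deriv c p)) x = 0" by (rule Suc.IH)
  have comm: "(pderiv ^^ j) (exp_deriv c p) = (pderiv ^^ Suc j) p + smult c ((pderiv ^^ j) p)" for j
    by (induction j) (simp_all add: exp_deriv_def pderiv_add pderiv_smult)
  have "poly ((pderiv ^^ j) p) x = 0" if "j < Suc M" for j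
    using that
  proof (induction j)
    case 0
    then show ?case using Suc.prems by auto
  next
    case (Suc j)
    then have "poly ((pderiv ^^ j) (exp_deriv c p)) x = 0" using * by auto
    with Suc show ?case by (simp add: comm)
  qed
  then show ?case by blast
qed simp

text \<open>
  The polynomial case uses the same counting: after \<open>degree p\<close> differentiations only a constant is left, which
  would still have a zero.
\<close>
lemma poly_eq_0_if_zeros_at_least:
  fixes p :: "real poly"
  assumes deg: "degree p < d \<or> p = 0" and "zeros_at_least (\<lambda>j. poly ((pderiv ^^ j) p)) d"
  shows "p = 0"
proof (rule ccontr)
  assume "p \<noteq> 0"
  with deg have dd: "degree p < d" by simp
  have const: "\<exists>c. c \<noteq> 0 \<and> (pderiv ^^ degree p) p = [:c:]"
    using \<open>p \<noteq> 0\<close>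
  proof (induction "degree p" arbitrary: p)
    case 0
    then show ?case by (auto elim!: degree_eq_zeroE)
  next
    case (Suc n)
    have "degree (pderiv p) = n" "pderiv p \<noteq> 0"
      using Suc.hyps(2) by (auto simp: degree_pderiv pderiv_eq_0_iff)
    with Suc.hyps(1)[of "pderiv p"] have "\<exists>c. c \<noteq> 0 \<and> (pderiv ^^ n) (pderiv p) = [:c:]" by simp
    then show ?case by (simp add: funpow_swap1 flip: Suc.hyps(2))
  qed
  obtain e where e: "d = degree p + Suc e" using dd less_imp_Suc_add by auto
  have "zeros_at_least (\<lambda>j. poly ((pderiv ^^ (degree p + j)) p)) (Suc e)"
    using zeros_at_least_iterated_deriv[of "\<lambda>j. poly ((pderiv ^^ j) p)" "degree p" "Suc e"]
      assms(2) e by (simp add: poly_DERIV)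
  then obtain S \<mu> where S: "finite S" "(\<Sum>x\<in>S. \<mu> x) = Suc e"
    "\<forall>x\<in>S. \<forall>j < \<mu> x. poly ((pderiv ^^ (degree p + j)) p) x = 0"
    by (auto simp: zeros_at_least_def)
  have "\<exists>x\<in>S. \<mu> x > 0"
  proof (rule ccontr)
    assume "\<not> ?thesis"
    hence "(\<Sum>x\<in>S. \<mu> x) = 0" by simp
    with S(2) show False by simp
  qed
  with S(3) obtain x where "poly ((pderiv ^^ (degree p + 0)) p) x = 0" by blast
  with const show False by auto
qed

text \<open>
  The derivative of order \<open>e\<close> of \<open>exp (c x) p + q\<close> no longer involves \<open>q\<close>; it is \<open>exp (c x) r\<close> with \<open>degree r < d\<close>
  and at least \<open>d\<close> zeros, so \<open>r = 0\<close>; as \<open>c \<noteq> 0\<close> the operator \<open>exp_deriv c\<close> is injective and \<open>p = 0\<close>.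
\<close>
lemma exp_poly_pair_eq_0_if_zeros:
  fixes p q :: "real poly" and d e :: nat
  assumes "c \<noteq> 0" and deg: "degree p < d \<or> p = 0" "degree q < e \<or> q = 0"
    and zeros: "zeros_at_least
      (\<lambda>j x. exp (c * x) * poly ((exp_deriv c ^^ j) p) x + poly ((pderiv ^^ j) q) x) (d + e)"
  shows "p = 0 \<and> q = 0"
proof -
  let ?f = "\<lambda>j x. exp (c * x) * poly ((exp_deriv c ^^ j) p) x + poly ((pderiv ^^ j) q) x"
  have der: "(?f j has_real_derivative ?f (Suc j) x) (at x)" for j x
    by (auto intro!: DERIV_add has_real_derivative_exp_mult_poly poly_DERIV)
  let ?r = "(exp_deriv c ^^ e) p"
  have q0: "(pderiv ^^ (e + j)) q = 0" for j
    using deg(2) by (intro iterated_pderiv_eq_0_if_degree_less) auto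
  have "zeros_at_least (\<lambda>j. ?f (e + j)) d"
    using zeros_at_least_iterated_deriv[of ?f e d, OF der] zeros by (simp add: add.commute)
  then obtain S \<mu> where S: "finite S" "(\<Sum>x\<in>S. \<mu> x) = d"
    "\<forall>x\<in>S. \<forall>j < \<mu> x. ?f (e + j) x = 0"
    by (auto simp: zeros_at_least_def)
  have "\<forall>j < \<mu> x. poly ((exp_deriv c ^^ j) ?r) x = 0" if "x \<in> S" for x
  proof (intro allI impI)
    fix j assume "j < \<mu> x"
    with S(3) that have "exp (c * x) * poly ((exp_deriv c ^^ (e + j)) p) x = 0" by (simp only: q0) simp
    then show "poly ((exp_deriv c ^^ j) ?r) x = 0" by (simp add: add.commute[of e] funpow_add)
  qed
  hence "zeros_at_least (\<lambda>j. poly ((pderiv ^^ j) ?r)) d"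
    unfolding zeros_at_least_def using S(1,2) vanishing_order_exp_deriv[of "\<mu> _" c ?r _]
    by (intro exI[of _ S] exI[of _ \<mu>]) blast
  moreover have "degree ?r < d \<or> ?r = 0"
  proof (cases "p = 0")
    case True
    have "(exp_deriv c ^^ k) 0 = 0" for k by (induction k) (simp_all add: exp_deriv_def)
    with True show ?thesis by simp
  qed (use deg(1) degree_iterated_exp_deriv_le[of e c p] in auto)
  ultimately have "?r = 0" by (rule poly_eq_0_if_zeros_at_least[rotated])
  hence "p = 0" by (rule iterated_exp_deriv_eq_0[OF \<open>c \<noteq> 0\<close>])
  have iter0: "(exp_deriv c ^^ j) 0 = 0" for j by (induction j) (simp_all add: exp_deriv_def)
  have "zeros_at_least (\<lambda>j. poly ((pderiv ^^ j) q)) (d + e)"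
    using zeros \<open>p = 0\<close> by (simp add: iter0)
  with deg(2) have "q = 0" by (intro poly_eq_0_if_zeros_at_least[of q "d + e"]) auto
  with \<open>p = 0\<close> show ?thesis by simp
qed

text \<open>
  Complex coefficients reduce to real ones: since exponents and points are real, real and imaginary
  parts of the coefficients satisfy the vanishing conditions separately.
\<close>
lemma exp_poly_pair_eq_0:
  fixes p q :: "complex poly" and c \<beta>\<^sub>1 \<beta>\<^sub>2 :: real
  assumes "c \<noteq> 0" "\<beta>\<^sub>1 \<noteq> \<beta>\<^sub>2" and deg: "degree p < d \<or> p = 0" "degree q < e \<or> q = 0"
    and "d + e \<le> M\<^sub>1 + M\<^sub>2"
    and zeros: "\<And>j \<beta>. j < M\<^sub>1 \<and> \<beta> = \<beta>\<^sub>1 \<or> j < M\<^sub>2 \<and> \<beta> = \<beta>\<^sub>2 \<Longrightarrow>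
      of_real (exp (c * \<beta>)) * poly ((exp_deriv (of_real c) ^^ j) p) (of_real \<beta>)
       + poly ((pderiv ^^ j) q) (of_real \<beta>) = 0"
  shows "p = 0 \<and> q = 0"
proof -
  have part: "map_poly g p = 0 \<and> map_poly g q = 0"
    if g: "g 0 = 0" "\<And>x y. g (x + y) = g x + g y" "\<And>r x. g (of_real r * x) = r * g x" for g :: "complex \<Rightarrow> real"
  proof -
    let ?g = "map_poly g"
    have gmul: "g (x * of_real r) = g x * r" for x r using g(3)[of r x] by (simp add: mult.commute)
    have gp: "poly (?g r) x = g (poly r (of_real x))" for r x
      by (induction r) (simp_all add: g map_poly_pCons)
    have gd: "?g (pderiv r) = pderiv (?g r)" for r
      using g(3)[of "real (Suc _)"] by (intro poly_eqI) (simp add: coeff_map_poly coeff_pderiv g)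
    have ge: "?g (exp_deriv (of_real c) r) = exp_deriv c (?g r)" for r
      unfolding exp_deriv_def by (intro poly_eqI) (simp add: coeff_map_poly g flip: gd)
    have gde: "?g ((exp_deriv (of_real c) ^^ j) r) = (exp_deriv c ^^ j) (?g r)"
      and gdd: "?g ((pderiv ^^ j) r) = (pderiv ^^ j) (?g r)" for j r
      by (induction j) (simp_all add: ge gd)
    have "degree (?g r) < k \<or> ?g r = 0" if "degree r < k \<or> r = 0" for r k
      using that map_poly_degree_leq[of g r] by (auto simp: g)
    note dg = this[OF deg(1)] this[OF deg(2)]
    \<comment> \<open>the counting lemma asks for exactly \<open>d + e\<close> zeros, so surplus multiplicity is dropped\<close>
    define K1 K2 where "K1 = min M\<^sub>1 (d + e)" and "K2 = d + e - K1"
    then have K: "K1 \<le> M\<^sub>1" "K2 \<le> M\<^sub>2" "K1 + K2 = d + e"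
      using \<open>d + e \<le> M\<^sub>1 + M\<^sub>2\<close> by auto
    have "zeros_at_least (\<lambda>j x. exp (c * x) * poly ((exp_deriv c ^^ j) (?g p)) x
        + poly ((pderiv ^^ j) (?g q)) x) (d + e)"
      unfolding zeros_at_least_def
    proof (intro exI[of _ "{\<beta>\<^sub>1, \<beta>\<^sub>2}"] exI[of _ "\<lambda>x. if x = \<beta>\<^sub>1 then K1 else K2"] conjI ballI allI impI)
      fix x j assume x: "x \<in> {\<beta>\<^sub>1, \<beta>\<^sub>2}" and j: "j < (if x = \<beta>\<^sub>1 then K1 else K2)"
      have "exp (c * x) * poly ((exp_deriv c ^^ j) (?g p)) x + poly ((pderiv ^^ j) (?g q)) x
         = g (of_real (exp (c * x)) * poly ((exp_deriv (of_real c) ^^ j) p) (of_real x)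
       + poly ((pderiv ^^ j) q) (of_real x))"
        by (simp only: g gp flip: gde gdd)
      also have "\<dots> = g 0"
        by (subst zeros) (use x j K in \<open>auto split: if_splits\<close>)
      finally show "exp (c * x) * poly ((exp_deriv c ^^ j) (?g p)) x + poly ((pderiv ^^ j) (?g q)) x = 0"
        by (simp add: g)
    qed (use \<open>\<beta>\<^sub>1 \<noteq> \<beta>\<^sub>2\<close> K in auto)
    then show ?thesis by (intro exp_poly_pair_eq_0_if_zeros[OF \<open>c \<noteq> 0\<close> dg])
  qed
  have re: "map_poly Re p = 0 \<and> map_poly Re q = 0" and im: "map_poly Im p = 0 \<and> map_poly Im q = 0"
    by (rule part; simp)+
  have "r = 0" if "map_poly Re r = 0" "map_poly Im r = 0" for r :: "complex poly"
  proof (rule poly_eqI)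
    fix i show "coeff r i = coeff 0 i"
      using arg_cong[OF that(1), of "\<lambda>r. coeff r i"] arg_cong[OF that(2), of "\<lambda>r. coeff r i"]
      by (simp add: coeff_map_poly complex_eq_iff)
  qed
  with re im show ?thesis by blast
qed

section \<open>Boundary values of functions holomorphic off the real line\<close>

text \<open>
  Unrestricted limits at every point of \<open>Y\<close> glue to a continuous function: near \<open>x\<close> all values of \<open>f\<close>
  are close to \<open>h x\<close>, hence so are all limits of \<open>f\<close> at nearby points.
\<close>
lemma continuous_on_limit_extension:
  fixes f h :: "'a::metric_space \<Rightarrow> 'b::metric_space"
  assumes lim: "\<And>x. x \<in> Y \<Longrightarrow> (f \<longlongrightarrow> h x) (at x within X)"
    and acc: "\<And>x. x \<in> Y \<Longrightarrow> at x within X \<noteq> bot"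
  shows "continuous_on Y h"
  unfolding continuous_on_iff
proof (intro ballI allI impI)
  fix x and e :: real assume x: "x \<in> Y" and e: "e > 0"
  then have "\<forall>\<^sub>F z in at x within X. dist (f z) (h x) < e / 2"
    using lim[OF x] unfolding tendsto_iff by (meson half_gt_zero)
  then obtain d where d: "d > 0" "\<And>z. z \<in> X \<Longrightarrow> z \<noteq> x \<Longrightarrow> dist z x < d \<Longrightarrow> dist (f z) (h x) < e / 2"
    by (auto simp: eventually_at)
  have "dist (h y) (h x) < e" if y: "y \<in> Y" "dist y x < d" for y
  proof (cases "y = x")
    case False
    have "\<forall>\<^sub>F z in at y within X. z \<in> ball x d - {x}"
      by (rule eventually_at_topological[THEN iffD2], rule exI[of _ "ball x d - {x}"])
         (use False y in \<open>auto simp: dist_commute\<close>)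
    moreover have "\<forall>\<^sub>F z in at y within X. z \<in> X"
      by (auto simp: eventually_at_filter)
    ultimately have "\<forall>\<^sub>F z in at y within X. dist (f z) (h x) \<le> e / 2"
      by eventually_elim (use d(2) in \<open>force simp: dist_commute\<close>)
    then have "dist (h y) (h x) \<le> e / 2"
      by (intro tendsto_upperbound[OF _ _ acc[OF y(1)]])
         (auto intro!: tendsto_dist lim[OF y(1)])
    with e show ?thesis by simp
  qed (use e in simp)
  with d(1) show "\<exists>d>0. \<forall>y\<in>Y. dist y x < d \<longrightarrow> dist (h y) (h x) < e" by blast
qed

lemma continuous_on_upper_half_plane_extension:
  assumes hol: "f holomorphic_on {z. Im z > 0}"
    and lim: "\<And>x. (f \<longlongrightarrow> g x) (at (of_real x) within {z. Im z > 0})"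
  shows "continuous_on {z. Im z \<ge> 0} (\<lambda>z. if Im z > 0 then f z else g (Re z))"
proof (rule continuous_on_limit_extension[where f = f and X = "{z. Im z > 0}"])
  fix z :: complex assume z: "z \<in> {z. Im z \<ge> 0}"
  show "(f \<longlongrightarrow> (if Im z > 0 then f z else g (Re z))) (at z within {z. Im z > 0})"
  proof (cases "Im z > 0")
    case True
    then show ?thesis
      using holomorphic_on_imp_continuous_on[OF hol] by (auto simp: continuous_on_def)
  next
    case False
    with z have "z = of_real (Re z)" by (auto simp: complex_eq_iff)
    with lim[of "Re z"] False show ?thesis by simp
  qed
  show "at z within {z. Im z > 0} \<noteq> bot"
  proof -
    have "z islimpt {z. Im z > 0}"
      unfolding islimpt_approachable
    proof (intro allI impI)
      fix e :: real assume "e > 0"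
      with z show "\<exists>x'\<in>{z. Im z > 0}. x' \<noteq> z \<and> dist x' z < e"
        by (intro bexI[of _ "z + \<i> * of_real (e / 2)"]) (auto simp: dist_norm norm_mult)
    qed
    then show ?thesis by (simp add: trivial_limit_within)
  qed
qed

text \<open>
  Cauchy's theorem for the closed upper half disc of radius \<open>R\<close>, which needs only continuity up to the
  boundary. The arc contributes \<open>\<i> \<pi> \<tau>\<close> from \<open>\<tau> / z\<close> plus an error of at most \<open>B\<close> times its length.
\<close>
lemma boundary_integral_upper_half_plane:
  fixes f :: "complex \<Rightarrow> complex"
  assumes hol: "f holomorphic_on {z. Im z > 0}"
    and lim: "\<And>x. (f \<longlongrightarrow> g x) (at (of_real x) within {z. Im z > 0})"
    and asy: "\<And>z. Im z > 0 \<Longrightarrow> norm z = R \<Longrightarrow> norm (f z - \<tau> / z) \<le> B"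
    and "R > 0" "B \<ge> 0"
  shows "norm (integral {-R..R} g + \<i> * pi * \<tau>) \<le> B * R * pi" "continuous_on UNIV g"
proof -
  define h where "h = (\<lambda>z. if Im z > 0 then f z else g (Re z))"
  have cont: "continuous_on {z. Im z \<ge> 0} h"
    unfolding h_def by (rule continuous_on_upper_half_plane_extension[OF hol lim])
  have hg: "h (of_real x) = g x" for x by (simp add: h_def)
  show "continuous_on UNIV g"
    using continuous_on_compose2[OF cont, of UNIV complex_of_real]
    by (auto simp: hg image_subset_iff intro!: continuous_intros)
  define arc where "arc = part_circlepath 0 R 0 pi"
  define seg where "seg = linepath (complex_of_real (-R)) (of_real R)"
  have arc_image: "z \<in> path_image arc \<Longrightarrow> norm z = R \<and> Im z \<ge> 0" for z
    using \<open>R > 0\<close>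
    by (auto simp: arc_def path_image_part_circlepath' norm_mult norm_cis sin_ge_zero closed_segment_eq_real_ivl)
  have seg_image: "path_image seg \<subseteq> {z. Im z \<ge> 0}"
    by (auto simp: seg_def closed_segment_def)
  have arc_ends: "pathstart arc = of_real R" "pathfinish arc = of_real (-R)"
    by (auto simp: arc_def)
  have seg_ends: "pathstart seg = of_real (-R)" "pathfinish seg = of_real R" by (auto simp: seg_def)
  have conv: "convex {z. Im z \<ge> 0}" by (rule convex_halfspace_Im_ge)
  have int_hs: "interior {z. Im z \<ge> 0} = {z. Im z > 0}"
  proof -
    have "interior {z. inner \<i> z \<ge> 0} = {z. inner \<i> z > 0}" by (rule interior_halfspace_ge) simp
    then show ?thesis by simp
  qed
  have "(h has_contour_integral 0) (seg +++ arc)"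
  proof (rule Cauchy_theorem_convex[OF cont conv, of "{}"])
    fix z assume "z \<in> interior {z. Im z \<ge> 0} - {}"
    then have z: "z \<in> {z. Im z > 0}" by (simp add: int_hs)
    have "h holomorphic_on {z. Im z > 0}"
      using hol by (rule holomorphic_transform) (simp add: h_def)
    with z show "h field_differentiable at z"
      by (intro holomorphic_on_imp_differentiable_at) (auto simp: open_halfspace_Im_gt)
  qed (use arc_image seg_image arc_ends seg_ends in
        \<open>auto simp: path_image_join arc_def seg_def intro!: valid_path_join\<close>)
  moreover have seg_int: "h contour_integrable_on seg"
    unfolding seg_def
    by (rule contour_integrable_continuous_linepath)
       (rule continuous_on_subset[OF cont], use seg_image in \<open>simp add: seg_def\<close>)
  moreover have arc_int: "h contour_integrable_on arc"
    unfolding arc_def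
    by (rule contour_integrable_continuous_part_circlepath)
       (rule continuous_on_subset[OF cont], use arc_image in \<open>auto simp: arc_def\<close>)
  ultimately have "contour_integral seg h + contour_integral arc h = 0"
    using contour_integral_unique contour_integral_join[of h seg arc] arc_ends seg_ends
    by (simp add: arc_def seg_def)
  moreover have "contour_integral seg h = integral {-R..R} g"
    unfolding seg_def using \<open>R > 0\<close> by (subst contour_integral_linepath_Reals_eq) (auto simp: hg)
  ultimately have eq: "contour_integral arc h = - integral {-R..R} g"
    by (simp add: eq_neg_iff_add_eq_0 add.commute)
  have "((\<lambda>t. \<tau> / (0 + of_real R * cis t) * R * \<i> * cis t) has_integral (\<i> * pi * \<tau>)) {0..pi}"
  proof -
    have "((\<lambda>t. \<i> * \<tau>) has_integral (pi - 0) *\<^sub>R (\<i> * \<tau>)) {0..pi}"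
      using has_integral_const_real[of "\<i> * \<tau>" 0 pi] by simp
    moreover have "(\<lambda>t. \<tau> / (0 + of_real R * cis t) * R * \<i> * cis t) = (\<lambda>t. \<i> * \<tau>)"
      using \<open>R > 0\<close> by (auto simp: fun_eq_iff)
    ultimately show ?thesis by (simp add: scaleR_conv_of_real mult_ac)
  qed
  then have "((\<lambda>z. \<tau> / z) has_contour_integral (\<i> * pi * \<tau>)) arc"
    unfolding arc_def by (subst has_contour_integral_part_circlepath_iff) auto
  then have diff: "((\<lambda>z. h z - \<tau> / z) has_contour_integral
      (- integral {-R..R} g - \<i> * pi * \<tau>)) arc"
    using has_contour_integral_integral[OF arc_int] unfolding eq
    by (intro has_contour_integral_diff)
  \<comment> \<open>the two end points of the arc are real, where the bound on \<open>f\<close> is not available\<close>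
  have "norm (- integral {-R..R} g - \<i> * pi * \<tau>) \<le> B * R * (pi - 0)"
  proof (rule has_contour_integral_bound_part_circlepath_strong[OF diff[unfolded arc_def]])
    show "finite {complex_of_real R, of_real (-R)}" by simp
    fix z assume z: "z \<in> path_image (part_circlepath 0 R 0 pi) - {complex_of_real R, of_real (-R)}"
    then have "norm z = R" "Im z \<ge> 0" using arc_image[of z] by (auto simp: arc_def)
    moreover have "Im z \<noteq> 0"
    proof
      assume "Im z = 0"
      then have "z = of_real (Re z)" by (simp add: complex_eq_iff)
      with \<open>norm z = R\<close> have "Re z = R \<or> Re z = -R" by (metis abs_eq_iff norm_of_real abs_of_pos \<open>R > 0\<close>)
      with z \<open>z = of_real (Re z)\<close> show False by auto
    qed
    ultimately show "norm (h z - \<tau> / z) \<le> B" using asy by (simp add: h_def)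
  qed (use assms in auto)
  moreover have "- integral {-R..R} g - \<i> * pi * \<tau> = - (integral {-R..R} g + \<i> * pi * \<tau>)" by simp
  ultimately show "norm (integral {-R..R} g + \<i> * pi * \<tau>) \<le> B * R * pi" by (simp only: norm_minus_cancel) simp
qed

lemma tendsto_integral_symmetric_interval:
  fixes g :: "real \<Rightarrow> complex"
  assumes "integrable lborel g"
  shows "((\<lambda>R. integral {-R..R} g) \<longlongrightarrow> (\<integral>x. g x \<partial>lborel)) at_top"
proof -
  have "((\<lambda>R. \<integral>x. indicator {-R..R} x *\<^sub>R g x \<partial>lborel) \<longlongrightarrow> (\<integral>x. g x \<partial>lborel)) at_top"
  proof (rule integral_dominated_convergence_at_top[where w = "\<lambda>x. norm (g x)"])
    show "\<forall>\<^sub>F R in at_top. AE x in lborel. norm (indicator {-R..R} x *\<^sub>R g x) \<le> norm (g x)"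
      by (intro always_eventually allI AE_I2) (auto simp: indicator_def)
    show "AE x in lborel. ((\<lambda>R. indicator {-R..R} x *\<^sub>R g x) \<longlongrightarrow> g x) at_top"
    proof (intro AE_I2 tendsto_eventually)
      fix x :: real
      show "\<forall>\<^sub>F R in at_top. indicator {-R..R} x *\<^sub>R g x = g x"
        using eventually_ge_at_top[of "\<bar>x\<bar>"] by eventually_elim (auto simp: indicator_def)
    qed
  qed (use assms in \<open>auto intro: borel_measurable_integrable\<close>)
  moreover have "(\<integral>x. indicator {-R..R} x *\<^sub>R g x \<partial>lborel) = integral {-R..R} g" for R
    using set_borel_integral_eq_integral(2)[of "{-R..R}" g] assms
    by (simp add: set_integrable_def set_lebesgue_integral_def integrable_mult_indicator)
  ultimately show ?thesis by simp
qed

lemma holomorphic_on_reflect_half_plane: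
  assumes "f holomorphic_on {z. Im z < 0}"
  shows "(\<lambda>z. f (- z)) holomorphic_on {z. Im z > 0}"
proof -
  have "(f \<circ> uminus) holomorphic_on {z. Im z > 0}"
    by (rule holomorphic_on_compose_gen[OF _ assms]) (auto intro!: holomorphic_intros)
  then show ?thesis by (simp add: o_def)
qed

lemma boundary_limit_reflect_half_plane:
  assumes "\<And>x. (f \<longlongrightarrow> g x) (at (of_real x) within {z. Im z < 0})"
  shows "((\<lambda>z. f (- z)) \<longlongrightarrow> g (- x)) (at (of_real x) within {z. Im z > 0})"
proof -
  have "filterlim uminus (at (of_real (-x)) within {z. Im z < 0}) (at (complex_of_real x) within {z. Im z > 0})"
    unfolding filterlim_at by (auto simp: eventually_at_filter intro!: tendsto_eq_intros)
  from filterlim_compose[OF assms this] show ?thesis by simp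
qed

text \<open>
  The residue at infinity: \<open>\<tau>\<close> is the coefficient of \<open>1 / z\<close>. The lower half plane is reduced to the
  upper one by \<open>z \<mapsto> - z\<close>, which exchanges the boundary values and changes the sign of \<open>\<tau>\<close>.
\<close>
lemma boundary_jump_integral:
  fixes f :: "complex \<Rightarrow> complex"
  assumes hol: "f holomorphic_on - \<real>"
    and upper: "\<And>x. (f \<longlongrightarrow> u x) (at (of_real x) within {z. Im z > 0})"
    and lower: "\<And>x. (f \<longlongrightarrow> v x) (at (of_real x) within {z. Im z < 0})"
    and asy: "\<And>z. z \<notin> \<real> \<Longrightarrow> norm z \<ge> R\<^sub>0 \<Longrightarrow> norm (f z - \<tau> / z) \<le> K / norm z ^ 2"
    and "integrable lborel (\<lambda>x. u x - v x)"
  shows "(\<integral>x. u x - v x \<partial>lborel) = - 2 * pi * \<i> * \<tau>"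
proof -
  have hol': "f holomorphic_on {z. Im z > 0}" "f holomorphic_on {z. Im z < 0}"
    using hol by (auto intro!: holomorphic_on_subset[OF hol] simp: complex_is_Real_iff)
  note hol_neg = holomorphic_on_reflect_half_plane[OF hol'(2)]
  note lower_neg = boundary_limit_reflect_half_plane[OF lower]
  have error_bound: "norm (integral {-R..R} (\<lambda>x. u x - v x) + 2 * pi * \<i> * \<tau>) \<le> 2 * \<bar>K\<bar> * pi / R"
    if "R \<ge> max 1 R\<^sub>0" for R
  proof -
    have R: "R > 0" "R \<ge> R\<^sub>0" using that by auto
    have asy': "norm (f z - \<tau> / z) \<le> \<bar>K\<bar> / R ^ 2" if "z \<notin> \<real>" "norm z = R" for z
      by (rule order_trans[OF asy]) (use that R in \<open>auto intro!: divide_right_mono\<close>)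
    have asy_neg: "norm (f (- z) - (- \<tau>) / z) \<le> \<bar>K\<bar> / R ^ 2" if "z \<notin> \<real>" "norm z = R" for z
      using asy'[of "- z"] that by simp
    have 1: "norm (integral {-R..R} u + \<i> * pi * \<tau>) \<le> \<bar>K\<bar> / R ^ 2 * R * pi" "continuous_on UNIV u"
      using asy' R by (intro boundary_integral_upper_half_plane[OF hol'(1) upper, of R \<tau> "\<bar>K\<bar> / R ^ 2"];
        auto simp: complex_is_Real_iff)+
    have 2: "norm (integral {-R..R} (\<lambda>x. v (- x)) + \<i> * pi * (- \<tau>)) \<le> \<bar>K\<bar> / R ^ 2 * R * pi"
       "continuous_on UNIV (\<lambda>x. v (- x))"
      using asy_neg R by (intro boundary_integral_upper_half_plane[OF hol_neg lower_neg, of R "- \<tau>" "\<bar>K\<bar> / R ^ 2"];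
        auto simp: complex_is_Real_iff)+
    have "continuous_on UNIV (\<lambda>x. v (- (- x)))"
      by (rule continuous_on_compose2[OF 2(2), of UNIV "\<lambda>x. - x"]) (auto intro!: continuous_intros)
    then have "continuous_on UNIV v" by simp
    then have ints: "u integrable_on {-R..R}" "v integrable_on {-R..R}"
      using 1(2) by (auto intro!: integrable_continuous_real intro: continuous_on_subset)
    have "integral {-R..R} (\<lambda>x. v (- x)) = integral {-R..R} v"
      using Henstock_Kurzweil_Integration.integral_reflect_real[of R "-R" v] by simp
    with 2(1) have 3: "norm (integral {-R..R} v - \<i> * pi * \<tau>) \<le> \<bar>K\<bar> / R ^ 2 * R * pi" by simp
    have "integral {-R..R} (\<lambda>x. u x - v x) + 2 * pi * \<i> * \<tau>
       = (integral {-R..R} u + \<i> * pi * \<tau>) - (integral {-R..R} v - \<i> * pi * \<tau>)"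
      using ints by (simp add: Henstock_Kurzweil_Integration.integral_diff algebra_simps)
    also have "norm \<dots> \<le> \<bar>K\<bar> / R ^ 2 * R * pi + \<bar>K\<bar> / R ^ 2 * R * pi"
      by (rule order_trans[OF norm_triangle_ineq4 add_mono[OF 1(1) 3]])
    also have "\<dots> = 2 * \<bar>K\<bar> * pi / R" using R by (simp add: field_simps power2_eq_square)
    finally show ?thesis .
  qed
  have "((\<lambda>R. integral {-R..R} (\<lambda>x. u x - v x) + 2 * pi * \<i> * \<tau>) \<longlongrightarrow> 0) at_top"
  proof (rule Lim_null_comparison)
    show "\<forall>\<^sub>F R in at_top. norm (integral {-R..R} (\<lambda>x. u x - v x) + 2 * pi * \<i> * \<tau>) \<le> 2 * \<bar>K\<bar> * pi / R"
      using eventually_ge_at_top[of "max 1 R\<^sub>0"] by eventually_elim (rule error_bound)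
    show "((\<lambda>R. 2 * \<bar>K\<bar> * pi / R) \<longlongrightarrow> 0) at_top"
      by (intro tendsto_divide_0[OF tendsto_const] filterlim_at_top_imp_at_infinity filterlim_ident)
  qed
  moreover have "((\<lambda>R. integral {-R..R} (\<lambda>x. u x - v x) + 2 * pi * \<i> * \<tau>)
      \<longlongrightarrow> (\<integral>x. u x - v x \<partial>lborel) + 2 * pi * \<i> * \<tau>) at_top"
    by (intro tendsto_add tendsto_const tendsto_integral_symmetric_interval assms)
  ultimately have "(\<integral>x. u x - v x \<partial>lborel) + 2 * pi * \<i> * \<tau> = 0"
    by (rule tendsto_unique[OF trivial_limit_at_top_linorder, rotated])
  then show ?thesis by (simp add: eq_neg_iff_add_eq_0)
qed

text \<open>
  Equal boundary values from both sides make the function continuous on the plane, hence entire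
  (a line is removable for continuous functions), and Liouville's theorem for functions of polynomial growth applies.
\<close>
lemma polynomial_if_no_jump:
  fixes f :: "complex \<Rightarrow> complex"
  assumes hol: "f holomorphic_on - \<real>"
    and upper: "\<And>x. (f \<longlongrightarrow> g x) (at (of_real x) within {z. Im z > 0})"
    and lower: "\<And>x. (f \<longlongrightarrow> g x) (at (of_real x) within {z. Im z < 0})"
    and asy: "\<And>z. z \<notin> \<real> \<Longrightarrow> norm z \<ge> R \<Longrightarrow> norm (f z) \<le> K * norm z ^ n"
  obtains p where "\<And>z. z \<notin> \<real> \<Longrightarrow> f z = poly p z" "\<And>x. g x = poly p (of_real x)"
proof -
  have hol': "f holomorphic_on {z. Im z > 0}" "f holomorphic_on {z. Im z < 0}"
    by (auto intro!: holomorphic_on_subset[OF hol] simp: complex_is_Real_iff)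
  note hol_neg = holomorphic_on_reflect_half_plane[OF hol'(2)]
  note lower_neg = boundary_limit_reflect_half_plane[OF lower]
  define h where "h = (\<lambda>z. if Im z \<noteq> 0 then f z else g (Re z))"
  have "continuous_on {z. Im z \<ge> 0} h"
    using continuous_on_upper_half_plane_extension[OF hol'(1) upper]
    by (rule continuous_on_eq) (auto simp: h_def)
  moreover have "continuous_on {z. Im z \<le> 0} h"
  proof -
    have "continuous_on {z. Im z \<le> 0} (\<lambda>z. (\<lambda>z. if Im z > 0 then f (- z) else g (- Re z)) (- z))"
      by (rule continuous_on_compose2[OF continuous_on_upper_half_plane_extension[OF hol_neg lower_neg]])
         (auto intro!: continuous_intros)
    then show ?thesis by (rule continuous_on_eq) (auto simp: h_def)
  qed
  ultimately have "continuous_on ({z. Im z \<ge> 0} \<union> {z. Im z \<le> 0}) h"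
    by (intro continuous_on_closed_Un) (auto simp: closed_halfspace_Im_ge closed_halfspace_Im_le)
  moreover have "{z. Im z \<ge> 0} \<union> {z. Im z \<le> 0} = UNIV" by auto
  ultimately have cont: "continuous_on UNIV h" by simp
  have "h holomorphic_on UNIV"
  proof (rule holomorphic_on_paste_across_line[of UNIV \<i> h 0])
    show "h holomorphic_on UNIV \<inter> {z. \<i> \<bullet> z < 0}" "h holomorphic_on UNIV \<inter> {z. 0 < \<i> \<bullet> z}"
      using hol' by (auto simp: h_def intro: holomorphic_transform)
  qed (use cont in auto)
  moreover have bound: "norm (h z) \<le> K * norm z ^ n" if "norm z \<ge> R" for z
  proof (cases "Im z = 0")
    case False
    then show ?thesis using asy[of z] that by (auto simp: h_def complex_is_Real_iff)
  next
    case True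
    let ?z = "\<lambda>e::real. z + \<i> * of_real e"
    have lim: "(?z \<longlongrightarrow> z) (at_right 0)"
      by (auto intro!: tendsto_eq_intros)
    have "((\<lambda>e. h (?z e)) \<longlongrightarrow> h z) (at_right 0)"
      using continuous_on_tendsto_compose[OF cont lim] by simp
    moreover have "((\<lambda>e. K * norm (?z e) ^ n) \<longlongrightarrow> K * norm z ^ n) (at_right 0)"
      by (intro tendsto_intros lim)
    moreover have "\<forall>\<^sub>F e in at_right 0. norm (h (?z e)) \<le> K * norm (?z e) ^ n"
    proof -
      have "norm (h (?z e)) \<le> K * norm (?z e) ^ n" if "e > 0" for e
      proof -
        have "norm z \<le> norm (?z e)"
          using True by (simp add: cmod_def)
        then show ?thesis
          using asy[of "?z e"] \<open>R \<le> norm z\<close> that True by (auto simp: h_def complex_is_Real_iff)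
      qed
      then show ?thesis by (auto simp: eventually_at_right_field intro: exI[of _ 1])
    qed
    ultimately show ?thesis
      by (intro tendsto_le[OF trivial_limit_at_right_real _ tendsto_norm])
  qed
  ultimately have liou: "h z = (\<Sum>k\<le>n. (deriv ^^ k) h 0 / fact k * z ^ k)" for z
    by (intro Liouville_polynomial[of h R K n]) auto
  define p where "p = (\<Sum>k\<le>n. monom ((deriv ^^ k) h 0 / fact k) k)"
  have "h z = poly p z" for z
    by (subst liou) (simp add: p_def poly_sum poly_monom)
  then show ?thesis
    using that[of p] by (metis Im_complex_of_real Re_complex_of_real complex_is_Real_iff h_def)
qed

section \<open>Gaussian integrals of polynomials\<close>

definition gauss_weight :: "real \<Rightarrow> real \<Rightarrow> real \<Rightarrow> real" where
  "gauss_weight \<kappa> s x = exp (- (\<kappa> / 2) * (x\<^sup>2 - 2 * s * x))"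

definition gauss_int :: "real \<Rightarrow> real \<Rightarrow> complex poly \<Rightarrow> complex" where
  "gauss_int \<kappa> s p = (\<integral>x. poly p (of_real x) * of_real (gauss_weight \<kappa> s x) \<partial>lborel)"

text \<open>
  Completing the square: the weight is a constant times the normal density of mean \<open>s\<close> and variance
  \<open>1 / \<kappa>\<close>. This gives integrability and the total mass.
\<close>
lemma gauss_weight_normal_density:
  assumes "\<kappa> > 0"
  shows "gauss_weight \<kappa> s x = sqrt (2 * pi / \<kappa>) * exp (\<kappa> * s\<^sup>2 / 2) * normal_density s (1 / sqrt \<kappa>) x"
proof -
  have "exp (\<kappa> * s\<^sup>2 / 2) * exp (- ((x - s)\<^sup>2 * \<kappa> / 2)) = gauss_weight \<kappa> s x"
    unfolding gauss_weight_def mult_exp_exp by (simp add: power2_eq_square field_simps)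
  moreover have "normal_density s (1 / sqrt \<kappa>) x = exp (- ((x - s)\<^sup>2 * \<kappa> / 2)) / sqrt (2 * pi / \<kappa>)"
    using assms by (simp add: normal_density_def power_divide field_simps)
  ultimately show ?thesis using assms by simp
qed

lemma integrable_poly_gauss_weight:
  fixes p :: "complex poly"
  assumes "\<kappa> > 0"
  shows "integrable lborel (\<lambda>x. poly p (of_real x) * of_real (gauss_weight \<kappa> s x))"
proof -
  define q where "q = pcompose p [:of_real s, 1:]"
  have "poly p (of_real x) = (\<Sum>i\<le>degree q. coeff q i * of_real ((x - s) ^ i))" for x
  proof -
    have "poly p (of_real x) = poly q (of_real (x - s))" by (simp add: q_def poly_pcompose)
    then show ?thesis by (simp add: poly_altdef)
  qed
  then have eq: "(\<lambda>x. poly p (of_real x) * of_real (gauss_weight \<kappa> s x)) =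
    (\<lambda>x. \<Sum>i\<le>degree q. coeff q i * of_real (sqrt (2 * pi / \<kappa>) * exp (\<kappa> * s\<^sup>2 / 2))
        * of_real (normal_density s (1 / sqrt \<kappa>) x * (x - s) ^ i))"
    using gauss_weight_normal_density[OF assms]
    by (auto simp: sum_distrib_right sum_distrib_left intro!: sum.cong)
  show ?thesis
    unfolding eq using assms integrable_normal_moment[of "1 / sqrt \<kappa>" s]
    by (intro Bochner_Integration.integrable_sum integrable_mult_right integrable_of_real) auto
qed

lemma gauss_int_add: "\<kappa> > 0 \<Longrightarrow> gauss_int \<kappa> s (p + q) = gauss_int \<kappa> s p + gauss_int \<kappa> s q"
  unfolding gauss_int_def
  by (simp add: distrib_right integrable_poly_gauss_weight)

lemma gauss_int_smult: "gauss_int \<kappa> s (smult c p) = c * gauss_int \<kappa> s p"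
  unfolding gauss_int_def by (simp add: mult.assoc)

lemma gauss_int_0 [simp]: "gauss_int \<kappa> s 0 = 0"
  by (simp add: gauss_int_def)

lemma gauss_int_diff: "\<kappa> > 0 \<Longrightarrow> gauss_int \<kappa> s (p - q) = gauss_int \<kappa> s p - gauss_int \<kappa> s q"
  unfolding gauss_int_def
  by (simp add: left_diff_distrib integrable_poly_gauss_weight)

lemma gauss_int_1:
  assumes "\<kappa> > 0"
  shows "gauss_int \<kappa> s 1 = of_real (sqrt (2 * pi / \<kappa>) * exp (\<kappa> * s\<^sup>2 / 2))"
proof -
  have "gauss_int \<kappa> s 1 = of_real (\<integral>x. gauss_weight \<kappa> s x \<partial>lborel)"
    by (simp add: gauss_int_def)
  also have "(\<integral>x. gauss_weight \<kappa> s x \<partial>lborel) = sqrt (2 * pi / \<kappa>) * exp (\<kappa> * s\<^sup>2 / 2)"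
    using assms by (simp add: gauss_weight_normal_density)
  finally show ?thesis .
qed

lemma poly_gauss_weight_tendsto_0:
  fixes p :: "complex poly"
  assumes "\<kappa> > 0" and F: "F = at_top \<or> F = at_bot"
  shows "((\<lambda>x. poly p (of_real x) * of_real (gauss_weight \<kappa> s x)) \<longlongrightarrow> 0) F"
proof -
  let ?d = "degree p"
  have "filterlim (\<lambda>x::real. x) at_infinity F"
    using F by (auto intro: filterlim_at_top_imp_at_infinity filterlim_at_bot_imp_at_infinity filterlim_ident)
  then have inf: "filterlim (\<lambda>x. complex_of_real x) at_infinity F"
    by (intro filterlim_norm_at_top_imp_at_infinity)
       (simp add: filterlim_at_infinity_imp_norm_at_top flip: real_norm_def)
  have "((\<lambda>x. x ^ ?d * gauss_weight \<kappa> s x) \<longlongrightarrow> 0) F"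
    using F \<open>\<kappa> > 0\<close> unfolding gauss_weight_def by (elim disjE) (simp, real_asymp)+
  then have "((\<lambda>x. poly p (of_real x) / of_real x ^ ?d * of_real (x ^ ?d * gauss_weight \<kappa> s x))
      \<longlongrightarrow> lead_coeff p * of_real 0) F"
    by (intro tendsto_mult filterlim_compose[OF poly_divide_tendsto_aux inf] tendsto_of_real)
  then have *: "((\<lambda>x. poly p (of_real x) / of_real x ^ ?d * of_real (x ^ ?d * gauss_weight \<kappa> s x))
      \<longlongrightarrow> 0) F" by simp
  have "\<forall>\<^sub>F x in F. (x::real) \<noteq> 0"
    using F by (auto intro: eventually_not_equal_at_infinity)
  then show ?thesis
    by (intro Lim_transform_eventually[OF *] eventually_mono[OF \<open>\<forall>\<^sub>F x in F. x \<noteq> 0\<close>]) simp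
qed

text \<open>Integration by parts; the logarithmic derivative of the weight is \<open>- \<kappa> (x - s)\<close>.\<close>
lemma gauss_int_pderiv:
  assumes "\<kappa> > 0"
  shows "gauss_int \<kappa> s (pderiv p) = \<kappa> * gauss_int \<kappa> s ([:- of_real s, 1:] * p)"
proof -
  let ?q = "pderiv p - smult \<kappa> ([:- of_real s, 1:] * p)"
  let ?F = "\<lambda>x. poly p (of_real x) * of_real (gauss_weight \<kappa> s x)"
  let ?f = "\<lambda>x. poly ?q (of_real x) * of_real (gauss_weight \<kappa> s x)"
  have "(LBINT x=-\<infinity>..\<infinity>. ?f x) = 0 - 0"
  proof (rule interval_integral_FTC_integrable[where F = ?F])
    fix x :: real
    have w: "(gauss_weight \<kappa> s has_real_derivative (- \<kappa> * (x - s)) * gauss_weight \<kappa> s x) (at x)"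
      unfolding gauss_weight_def by (auto intro!: derivative_eq_intros simp: field_simps)
    have w': "((\<lambda>x. complex_of_real (gauss_weight \<kappa> s x)) has_vector_derivative
        of_real ((- \<kappa> * (x - s)) * gauss_weight \<kappa> s x)) (at x)"
      using w by (intro has_vector_derivative_of_real) (simp add: has_real_derivative_iff_has_vector_derivative)
    have "((\<lambda>x. poly p (complex_of_real x)) has_vector_derivative poly (pderiv p) (of_real x)) (at x)"
      by (intro has_vector_derivative_real_field poly_DERIV)
    from has_vector_derivative_mult[OF this w'] have "(?F has_vector_derivative (poly p (of_real x) * of_real ((- \<kappa> * (x - s)) * gauss_weight \<kappa> s x)
        + poly (pderiv p) (of_real x) * of_real (gauss_weight \<kappa> s x))) (at x)"
      by simp
    then show "(?F has_vector_derivative ?f x) (at x)"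
      by (simp add: algebra_simps)
    show "isCont ?f x"
      unfolding gauss_weight_def by (intro continuous_intros)
  next
    show "set_integrable lborel (einterval (-\<infinity>) \<infinity>) ?f"
      using integrable_poly_gauss_weight[OF assms, of ?q s] by (simp add: set_integrable_def)
    show "((?F \<circ> real_of_ereal) \<longlongrightarrow> 0) (at_right (-\<infinity>))" "((?F \<circ> real_of_ereal) \<longlongrightarrow> 0) (at_left \<infinity>)"
      using poly_gauss_weight_tendsto_0[OF assms, of _ p s]
      by (auto simp: ereal_tendsto_simps)
  qed auto
  then have "gauss_int \<kappa> s ?q = 0"
    by (simp add: set_lebesgue_integral_def gauss_int_def interval_lebesgue_integral_def)
  then show ?thesis
    using assms by (simp only: gauss_int_diff gauss_int_smult right_minus_eq)
qed

text \<open>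
  For \<open>\<kappa> > 0\<close> this is the heat flow \<open>exp (D\<^sup>2 / (2 \<kappa>))\<close>, which maps \<open>p\<close> to the polynomial \<open>s \<mapsto> E (p (s + X))\<close> for a centred normal
  variable \<open>X\<close> of variance \<open>1 / \<kappa>\<close>. The recursion expresses that conjugation by the flow turns
  multiplication by \<open>x\<close> into \<open>x + D / \<kappa>\<close>.
\<close>
definition heat :: "'a \<Rightarrow> 'a poly \<Rightarrow> 'a::field_char_0 poly" where
  "heat \<kappa> p = fold_coeffs (\<lambda>a q. [:a:] + pCons 0 q + smult (1 / \<kappa>) (pderiv q)) p 0"

lemma heat_0 [simp]: "heat \<kappa> 0 = 0"
  by (simp add: heat_def)

lemma heat_pCons: "heat \<kappa> (pCons a p) = [:a:] + pCons 0 (heat \<kappa> p) + smult (1 / \<kappa>) (pderiv (heat \<kappa> p))"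
  by (cases "a = 0 \<and> p = 0") (auto simp: heat_def)

lemma heat_add: "heat \<kappa> (p + q) = heat \<kappa> p + heat \<kappa> q"
  by (induction p q rule: poly_induct2) (simp_all add: heat_pCons pderiv_add smult_add_right)

lemma heat_smult: "heat \<kappa> (smult c p) = smult c (heat \<kappa> p)"
  by (induction p) (simp_all add: heat_pCons pderiv_smult smult_add_right mult.commute)

lemma heat_pderiv: "heat \<kappa> (pderiv p) = pderiv (heat \<kappa> p)"
  by (induction p) (simp_all add: heat_pCons pderiv_pCons heat_add pderiv_add pderiv_smult)

lemma degree_heat_le: "degree (heat \<kappa> p) \<le> degree p"
proof (induction p)
  case (pCons a p)
  show ?case
  proof (cases "p = 0")
    case False
    have "degree (pCons 0 (heat \<kappa> p)) \<le> Suc (degree p)"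
      using pCons.IH by (meson degree_pCons_le le_trans Suc_le_mono)
    moreover have "degree (smult (1 / \<kappa>) (pderiv (heat \<kappa> p))) \<le> Suc (degree p)"
      using pCons.IH by (intro order_trans[OF degree_smult_le]) (simp add: degree_pderiv)
    ultimately show ?thesis
      using False by (simp add: heat_pCons degree_add_le)
  qed (simp add: heat_pCons)
qed simp

lemma coeff_heat_degree: "coeff (heat \<kappa> p) (degree p) = lead_coeff p"
proof (induction p)
  case (pCons a p)
  have "coeff (heat \<kappa> p) (Suc (Suc (degree p))) = 0"
    using degree_heat_le[of \<kappa> p] by (intro coeff_eq_0) simp
  with pCons show ?case by (cases "p = 0") (auto simp: heat_pCons coeff_pderiv)
qed simp

lemma heat_eq_0: "heat \<kappa> p = 0 \<Longrightarrow> p = 0"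
  using coeff_heat_degree[of \<kappa> p] by simp

text \<open>
  Up to the total mass, the integral is a polynomial in the centre \<open>s\<close>, namely the heat flow of \<open>p\<close>.
  The induction is on the degree because integration by parts leads to the derivative of the tail.
\<close>
lemma gauss_int_heat:
  assumes "\<kappa> > 0"
  shows "gauss_int \<kappa> s p = gauss_int \<kappa> s 1 * poly (heat \<kappa> p) s"
proof (induction "degree p" arbitrary: p rule: less_induct)
  case less
  obtain a q where p: "p = pCons a q" by (cases p)
  have eq: "gauss_int \<kappa> s p = a * gauss_int \<kappa> s 1 + gauss_int \<kappa> s ([:0, 1:] * q)"
  proof -
    have "p = smult a 1 + [:0, 1:] * q" by (simp add: p)
    then show ?thesis using assms by (simp only: gauss_int_add gauss_int_smult)
  qed
  show ?case
  proof (cases "q = 0")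
    case True
    then show ?thesis using eq by (simp add: p heat_pCons)
  next
    case False
    have IH: "gauss_int \<kappa> s q = gauss_int \<kappa> s 1 * poly (heat \<kappa> q) s"
      "gauss_int \<kappa> s (pderiv q) = gauss_int \<kappa> s 1 * poly (heat \<kappa> (pderiv q)) s"
      using False by (auto intro!: less simp: p degree_pderiv)
    have "[:0, 1:] * q = [:- of_real s, 1:] * q + smult (of_real s) q" by simp
    then have "gauss_int \<kappa> s ([:0, 1:] * q) = gauss_int \<kappa> s ([:- of_real s, 1:] * q) + s * gauss_int \<kappa> s q"
      using assms by (simp only: gauss_int_add gauss_int_smult)
    moreover have "gauss_int \<kappa> s ([:- of_real s, 1:] * q) = gauss_int \<kappa> s (pderiv q) / \<kappa>"
      using assms by (simp add: gauss_int_pderiv)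
    ultimately show ?thesis
      using eq IH by (simp add: p heat_pCons heat_pderiv algebra_simps)
  qed
qed

lemma heat_exp_deriv: "heat \<kappa> ((exp_deriv c ^^ j) p) = (exp_deriv c ^^ j) (heat \<kappa> p)"
proof -
  have "heat \<kappa> (exp_deriv c q) = exp_deriv c (heat \<kappa> q)" for q
    by (simp add: exp_deriv_def heat_add heat_smult heat_pderiv)
  then show ?thesis by (induction j) simp_all
qed

lemma pcompose_shift_exp_deriv:
  "pcompose ((exp_deriv c ^^ j) p) [:a, 1:] = (exp_deriv c ^^ j) (pcompose p [:a, 1:])"
proof -
  have "pcompose (exp_deriv c q) [:a, 1:] = exp_deriv c (pcompose q [:a, 1:])" for q
    by (simp add: exp_deriv_def pcompose_add pcompose_smult pderiv_pcompose pderiv_pCons)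
  then show ?thesis by (induction j) simp_all
qed

lemma exp_deriv_smult: "(exp_deriv c ^^ j) (smult a p) = smult a ((exp_deriv c ^^ j) p)"
proof -
  have "exp_deriv c (smult a q) = smult a (exp_deriv c q)" for q
    by (simp add: exp_deriv_def pderiv_smult smult_add_right mult.commute)
  then show ?thesis by (induction j) simp_all
qed

text \<open>
  Monic Hermite polynomials centred at \<open>\<sigma>\<close> for the variance \<open>1 / \<kappa>\<close>. As test functions they are better
  than powers: by integration by parts, pairing with the next one amounts to applying one more
  constant coefficient operator to \<open>p\<close>.
\<close>
primrec hermite :: "'a \<Rightarrow> 'a \<Rightarrow> nat \<Rightarrow> 'a::field_char_0 poly" where
  "hermite \<kappa> \<sigma> 0 = 1"
| "hermite \<kappa> \<sigma> (Suc j) =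
     [:- \<sigma>, 1:] * hermite \<kappa> \<sigma> j - smult (1 / \<kappa>) (pderiv (hermite \<kappa> \<sigma> j))"

lemma degree_hermite: "degree (hermite \<kappa> \<sigma> j) \<le> j"
proof (induction j)
  case (Suc j)
  have "degree ([:- \<sigma>, 1:] * hermite \<kappa> \<sigma> j) \<le> Suc j"
    using Suc by (intro order_trans[OF degree_mult_le]) simp
  moreover have "degree (smult (1 / \<kappa>) (pderiv (hermite \<kappa> \<sigma> j))) \<le> Suc j"
    using Suc by (intro order_trans[OF degree_smult_le]) (simp add: degree_pderiv)
  ultimately show ?case by (simp add: degree_diff_le)
qed simp

lemma gauss_int_hermite:
  fixes \<kappa> s \<sigma> :: real
  assumes "\<kappa> > 0"
  shows "gauss_int \<kappa> s (p * hermite \<kappa> \<sigma> j)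
    = gauss_int \<kappa> s ((exp_deriv (of_real (\<kappa> * (s - \<sigma>))) ^^ j) p) / \<kappa> ^ j"
proof (induction j arbitrary: p)
  case (Suc j)
  let ?r = "hermite (of_real \<kappa>) (of_real \<sigma>) j :: complex poly"
  have "p * hermite \<kappa> \<sigma> (Suc j)
     = [:- of_real s, 1:] * (p * ?r) + smult (of_real (s - \<sigma>)) (p * ?r) - smult (1 / \<kappa>) (p * pderiv ?r)"
    by (simp add: algebra_simps smult_diff_left)
  then have "gauss_int \<kappa> s (p * hermite \<kappa> \<sigma> (Suc j))
     = gauss_int \<kappa> s ([:- of_real s, 1:] * (p * ?r)) + (s - \<sigma>) * gauss_int \<kappa> s (p * ?r)
       - 1 / \<kappa> * gauss_int \<kappa> s (p * pderiv ?r)"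
    using assms by (simp only: gauss_int_add gauss_int_diff gauss_int_smult)
  also have "gauss_int \<kappa> s ([:- of_real s, 1:] * (p * ?r)) = 1 / \<kappa> * gauss_int \<kappa> s (pderiv (p * ?r))"
    using gauss_int_pderiv[OF assms, of s "p * ?r"] assms by simp
  also have "gauss_int \<kappa> s (pderiv (p * ?r)) = gauss_int \<kappa> s (p * pderiv ?r) + gauss_int \<kappa> s (pderiv p * ?r)"
    using assms by (simp add: pderiv_mult gauss_int_add mult.commute)
  also have "1 / \<kappa> * (gauss_int \<kappa> s (p * pderiv ?r) + gauss_int \<kappa> s (pderiv p * ?r))
       + (s - \<sigma>) * gauss_int \<kappa> s (p * ?r) - 1 / \<kappa> * gauss_int \<kappa> s (p * pderiv ?r)
     = 1 / \<kappa> * (gauss_int \<kappa> s (pderiv p * ?r) + \<kappa> * (s - \<sigma>) * gauss_int \<kappa> s (p * ?r))"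
    using assms by (simp add: field_simps)
  also have "\<dots> = 1 / \<kappa> * gauss_int \<kappa> s (exp_deriv (of_real (\<kappa> * (s - \<sigma>))) p * ?r)"
    using assms by (simp add: exp_deriv_def distrib_right gauss_int_add gauss_int_smult)
  finally show ?case by (simp add: Suc.IH funpow_swap1)
qed simp

text \<open>
  Test with the Hermite polynomials centred at \<open>\<alpha>\<^sub>2 + \<beta>\<close>. In the second integral the centre agrees with
  that of the weight and the operator is \<open>D\<close>; in the first it is \<open>D + \<kappa> (\<alpha>\<^sub>1 - \<alpha>\<^sub>2)\<close>. After division by the
  common Gaussian factor, the \<open>j\<close>-th condition is that the \<open>j\<close>-th derivative at \<open>\<beta>\<close> of
  \<open>e\<^sup>c\<^sup>\<beta> P(\<beta>) + Q(\<beta>)\<close> vanishes, where \<open>P\<close> and \<open>Q\<close> are the shifted heat flows of \<open>A\<close> and \<open>B\<close>.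
\<close>
lemma gauss_orthogonal_pair_eq_0:
  fixes A B :: "complex poly" and \<kappa> \<alpha>\<^sub>1 \<alpha>\<^sub>2 \<beta>\<^sub>1 \<beta>\<^sub>2 :: real
  assumes "\<kappa> > 0" "\<alpha>\<^sub>1 \<noteq> \<alpha>\<^sub>2" "\<beta>\<^sub>1 \<noteq> \<beta>\<^sub>2"
    and deg: "degree A < d \<or> A = 0" "degree B < e \<or> B = 0" and "d + e \<le> M\<^sub>1 + M\<^sub>2"
    and orth: "\<And>j \<beta> r. j < M\<^sub>1 \<and> \<beta> = \<beta>\<^sub>1 \<or> j < M\<^sub>2 \<and> \<beta> = \<beta>\<^sub>2 \<Longrightarrow> degree r \<le> j \<Longrightarrow>
       gauss_int \<kappa> (\<alpha>\<^sub>1 + \<beta>) (A * r) + gauss_int \<kappa> (\<alpha>\<^sub>2 + \<beta>) (B * r) = 0"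
  shows "A = 0 \<and> B = 0"
proof -
  define c where "c = \<kappa> * (\<alpha>\<^sub>1 - \<alpha>\<^sub>2)"
  \<comment> \<open>\<open>C exp (c \<beta>)\<close> is the ratio of the total masses of the weights centred at \<open>\<alpha>\<^sub>1 + \<beta>\<close> and \<open>\<alpha>\<^sub>2 + \<beta>\<close>\<close>
  define C where "C = exp (\<kappa> * (\<alpha>\<^sub>1\<^sup>2 - \<alpha>\<^sub>2\<^sup>2) / 2)"
  define P where "P = smult (of_real C) (pcompose (heat \<kappa> A) [:of_real \<alpha>\<^sub>1, 1:])"
  define Q where "Q = pcompose (heat \<kappa> B) [:of_real \<alpha>\<^sub>2, 1:]"
  have "C \<noteq> 0" by (simp add: C_def)
  have pc0: "pcompose p [:a, 1:] = 0 \<longleftrightarrow> p = 0" for p :: "complex poly" and a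
    by (simp add: pcompose_eq_0_iff)
  have P0: "P = 0 \<longleftrightarrow> A = 0" and Q0: "Q = 0 \<longleftrightarrow> B = 0"
    using heat_eq_0 \<open>C \<noteq> 0\<close> by (auto simp: P_def Q_def pc0)
  have "P = 0 \<and> Q = 0"
  proof (rule exp_poly_pair_eq_0[of c \<beta>\<^sub>1 \<beta>\<^sub>2 P d Q e M\<^sub>1 M\<^sub>2])
    show "degree P < d \<or> P = 0" "degree Q < e \<or> Q = 0"
      using deg degree_heat_le[of \<kappa> A] degree_heat_le[of \<kappa> B] P0 Q0 \<open>C \<noteq> 0\<close>
      by (auto simp: P_def Q_def degree_pcompose)
    fix j \<beta> assume j: "j < M\<^sub>1 \<and> \<beta> = \<beta>\<^sub>1 \<or> j < M\<^sub>2 \<and> \<beta> = \<beta>\<^sub>2"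
    let ?G = "\<lambda>s. gauss_int \<kappa> s 1"
    let ?r = "hermite (of_real \<kappa>) (of_real (\<alpha>\<^sub>2 + \<beta>)) j :: complex poly"
    let ?p = "poly ((exp_deriv (of_real c) ^^ j) P) (of_real \<beta>)"
    let ?q = "poly ((pderiv ^^ j) Q) (of_real \<beta>)"
    have A: "of_real C * gauss_int \<kappa> (\<alpha>\<^sub>1 + \<beta>) (A * ?r) = ?G (\<alpha>\<^sub>1 + \<beta>) * ?p / \<kappa> ^ j"
      unfolding gauss_int_hermite[OF \<open>\<kappa> > 0\<close>]
      by (subst gauss_int_heat[OF \<open>\<kappa> > 0\<close>])
         (simp add: heat_exp_deriv P_def exp_deriv_smult c_def poly_pcompose flip: pcompose_shift_exp_deriv)
    have B: "gauss_int \<kappa> (\<alpha>\<^sub>2 + \<beta>) (B * ?r) = ?G (\<alpha>\<^sub>2 + \<beta>) * ?q / \<kappa> ^ j"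
    proof -
      have "?q = poly (pcompose (heat \<kappa> ((pderiv ^^ j) B)) [:of_real \<alpha>\<^sub>2, 1:]) (of_real \<beta>)"
        unfolding Q_def exp_deriv_0[symmetric] by (simp only: heat_exp_deriv pcompose_shift_exp_deriv)
      then show ?thesis
        unfolding gauss_int_hermite[OF \<open>\<kappa> > 0\<close>]
        by (subst gauss_int_heat[OF \<open>\<kappa> > 0\<close>]) (simp add: poly_pcompose)
    qed
    have G: "?G (\<alpha>\<^sub>1 + \<beta>) = of_real (C * exp (c * \<beta>)) * ?G (\<alpha>\<^sub>2 + \<beta>)"
    proof -
      have "exp (\<kappa> * (\<alpha>\<^sub>1 + \<beta>)\<^sup>2 / 2) = C * exp (c * \<beta>) * exp (\<kappa> * (\<alpha>\<^sub>2 + \<beta>)\<^sup>2 / 2)"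
        unfolding C_def c_def mult_exp_exp by (simp add: power2_eq_square field_simps)
      then show ?thesis by (simp add: gauss_int_1[OF \<open>\<kappa> > 0\<close>])
    qed
    have G0: "?G (\<alpha>\<^sub>2 + \<beta>) \<noteq> 0" using \<open>\<kappa> > 0\<close> by (simp add: gauss_int_1)
    have "0 = of_real C * (gauss_int \<kappa> (\<alpha>\<^sub>1 + \<beta>) (A * ?r) + gauss_int \<kappa> (\<alpha>\<^sub>2 + \<beta>) (B * ?r))"
      using orth[OF j degree_hermite] by simp
    also have "\<dots> = of_real C * (?G (\<alpha>\<^sub>2 + \<beta>) / \<kappa> ^ j) * (of_real (exp (c * \<beta>)) * ?p + ?q)"
      using A B G by (simp add: algebra_simps add_divide_distrib)
    finally show "of_real (exp (c * \<beta>)) * ?p + ?q = 0"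
      using G0 \<open>C \<noteq> 0\<close> \<open>\<kappa> > 0\<close> by simp
  qed (use assms in \<open>auto simp: c_def\<close>)
  with P0 Q0 show ?thesis by simp
qed

section \<open>Mixed orthogonality for the Gaussian weights\<close>

lemma two_index_cases:
  fixes k k' j :: 2
  shows "k \<noteq> k' \<Longrightarrow> j = k \<or> j = k'"
  using exhaust_2[of k] exhaust_2[of k'] exhaust_2[of j] by auto

lemma sum_two_indices:
  fixes k k' :: 2
  assumes "k \<noteq> k'"
  shows "sum f UNIV = f k + f k'"
proof -
  have "UNIV = {k, k'}" using two_index_cases[OF assms] by auto
  show ?thesis unfolding \<open>UNIV = {k, k'}\<close> using assms by simp
qed

text \<open>
  The convention that the degree bound \<open>d - 1\<close> means \<open>p = 0\<close> for \<open>d = 0\<close> becomes uniform in terms of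
  coefficients.
\<close>
lemma degree_less_iff_coeff: "(p = 0 \<or> degree p < d) \<longleftrightarrow> (\<forall>i\<ge>d. coeff p i = 0)"
  by (metis coeff_eq_0 coeff_0 le_degree leading_coeff_0_iff linorder_not_less order_less_le_trans)

locale gaussian_weights =
  fixes N t :: real and a b :: "real ^ 2"
  assumes N: "N > 0" and t: "0 < t" "t < 1" and a: "a $ 1 \<noteq> a $ 2" and b: "b $ 1 \<noteq> b $ 2"
begin

definition \<kappa> :: real where "\<kappa> = N / (t * (1 - t))"

definition center :: "2 \<Rightarrow> 2 \<Rightarrow> real" where "center k l = (1 - t) * a $ k + t * b $ l"

definition pairing :: "2 \<Rightarrow> complex poly ^ 2 \<Rightarrow> complex poly \<Rightarrow> complex" where
  "pairing l A r = (\<Sum>k\<in>UNIV. gauss_int \<kappa> (center k l) (A $ k * r))"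

lemma \<kappa>_pos: "\<kappa> > 0"
  using N t by (simp add: \<kappa>_def)

text \<open>
  The product of the two Gaussians is the Gaussian whose centre is the weighted mean of the two
  centres.
\<close>
lemma w1_mult_w2: "w1 N t a k x * w2 N t b l x = gauss_weight \<kappa> (center k l) x"
proof -
  have "- (N / (2 * t)) * (x\<^sup>2 - 2 * a $ k * x) + - (N / (2 * (1 - t))) * (x\<^sup>2 - 2 * b $ l * x)
     = - (\<kappa> / 2) * (x\<^sup>2 - 2 * center k l * x)"
  proof -
    have "\<And>u v w::real. u > 0 \<Longrightarrow> v > 0 \<Longrightarrow>
       - (N / (2 * u)) * (x\<^sup>2 - 2 * a $ k * x) + - (N / (2 * v)) * (x\<^sup>2 - 2 * b $ l * x)
       = - (N / (u * v) / 2) * ((u + v) * x\<^sup>2 - 2 * (v * a $ k + u * b $ l) * x)"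
      by (simp add: field_simps)
    from this[of t "1 - t"] show ?thesis using t by (simp add: \<kappa>_def center_def)
  qed
  then show ?thesis by (simp add: w1_def w2_def gauss_weight_def mult_exp_exp)
qed

lemma mop_Q_mult_w2:
  "mop_Q N t a A x * poly r (of_real x) * of_real (w2 N t b l x) =
     (\<Sum>k\<in>UNIV. poly (A $ k * r) (of_real x) * of_real (gauss_weight \<kappa> (center k l) x))"
  unfolding sum_2 w1_mult_w2[symmetric] mop_Q_def by (simp add: algebra_simps)

lemma integral_mop_Q_eq_pairing:
  "(\<integral>x. mop_Q N t a A x * poly r (of_real x) * of_real (w2 N t b l x) \<partial>lborel) = pairing l A r"
  unfolding mop_Q_mult_w2 pairing_def gauss_int_def
  by (rule Bochner_Integration.integral_sum) (rule integrable_poly_gauss_weight[OF \<kappa>_pos])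

lemma pairing_0_right [simp]: "pairing l A 0 = 0"
  by (simp add: pairing_def)

lemma pairing_add_right: "pairing l A (r + q) = pairing l A r + pairing l A q"
  by (simp add: pairing_def distrib_left gauss_int_add[OF \<kappa>_pos] sum.distrib)

lemma pairing_smult_right: "pairing l A (smult c r) = c * pairing l A r"
  by (simp add: pairing_def gauss_int_smult sum_distrib_left)

lemma pairing_diff_right: "pairing l A (r - q) = pairing l A r - pairing l A q"
  by (simp add: pairing_def right_diff_distrib gauss_int_diff[OF \<kappa>_pos] sum_subtractf)

lemma pairing_diff_left: "pairing l (A - B) r = pairing l A r - pairing l B r"
  by (simp add: pairing_def left_diff_distrib gauss_int_diff[OF \<kappa>_pos] sum_subtractf)

lemma pairing_smult_left: "pairing l (\<chi> k. smult c (A $ k)) r = c * pairing l A r"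
  by (simp add: pairing_def gauss_int_smult sum_distrib_left)

lemma pairing_mult: "pairing l (\<chi> k. q * A $ k) r = pairing l A (q * r)"
  by (simp add: pairing_def mult_ac)

lemma pairing_eq_0_if_degree_less:
  assumes "\<forall>j<M. pairing l A (monom 1 j) = 0" "\<forall>i\<ge>M. coeff r i = 0"
  shows "pairing l A r = 0"
proof -
  have *: "pairing l A (\<Sum>i\<in>I. f i) = (\<Sum>i\<in>I. pairing l A (f i))" if "finite I" for I :: "nat set" and f
    using that by induction (simp_all add: pairing_add_right)
  have "r = (\<Sum>i\<le>degree r. smult (coeff r i) (monom 1 i))"
    by (simp add: smult_monom poly_as_sum_of_monoms)
  then have "pairing l A r = pairing l A (\<Sum>i\<le>degree r. smult (coeff r i) (monom 1 i))"
    by (rule arg_cong)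
  also have "\<dots> = (\<Sum>i\<le>degree r. coeff r i * pairing l A (monom 1 i))"
    by (simp only: * finite_atMost pairing_smult_right)
  also have "\<dots> = 0"
  proof (rule sum.neutral, rule ballI)
    fix i show "coeff r i * pairing l A (monom 1 i) = 0"
      using assms by (cases "i < M") auto
  qed
  finally show ?thesis .
qed

text \<open>
  Normality of all indices. The inequality in place of an equality lets the same lemma prove
  uniqueness of the normalized vectors and that leading coefficients and moments do not vanish.
\<close>
lemma orthogonal_eq_0:
  assumes deg: "\<forall>k. \<forall>i\<ge>\<nu> $ k. coeff (A $ k) i = 0"
    and le: "\<nu> $ 1 + \<nu> $ 2 \<le> \<mu> $ 1 + \<mu> $ 2"
    and orth: "\<forall>l. \<forall>j<\<mu> $ l. pairing l A (monom 1 j) = 0"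
  shows "A = 0"
proof -
  have deg': "degree (A $ k) < \<nu> $ k \<or> A $ k = 0" for k
    using deg degree_less_iff_coeff[of "A $ k"] by blast
  have "A $ 1 = 0 \<and> A $ 2 = 0"
  proof (rule gauss_orthogonal_pair_eq_0[OF \<kappa>_pos, of "(1 - t) * a $ 1" "(1 - t) * a $ 2"
        "t * b $ 1" "t * b $ 2" "A $ 1" "\<nu> $ 1" "A $ 2" "\<nu> $ 2" "\<mu> $ 1" "\<mu> $ 2"])
    fix j \<beta> and r :: "complex poly"
    assume "j < \<mu> $ 1 \<and> \<beta> = t * b $ 1 \<or> j < \<mu> $ 2 \<and> \<beta> = t * b $ 2" and r: "degree r \<le> j"
    then obtain l where l: "j < \<mu> $ l" "\<beta> = t * b $ l" by blast
    have "pairing l A r = 0"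
      using orth l r by (intro pairing_eq_0_if_degree_less[of "\<mu> $ l"]) (auto intro: coeff_eq_0)
    then show "gauss_int \<kappa> ((1 - t) * a $ 1 + \<beta>) (A $ 1 * r)
        + gauss_int \<kappa> ((1 - t) * a $ 2 + \<beta>) (A $ 2 * r) = 0"
      by (simp add: pairing_def sum_2 center_def l)
  qed (use a b t le deg' in auto)
  then show ?thesis by (simp add: vec_eq_iff forall_2)
qed

text \<open>
  Two vectors with the same normalization differ by one whose \<open>k\<close>-th component has a smaller degree bound, while
  the number of orthogonality conditions stays the same, so normality applies to the difference.
\<close>
lemma mop_II_eqI:
  assumes norm: "\<nu> $ 1 + \<nu> $ 2 = \<mu> $ 1 + \<mu> $ 2 + 1"
    and deg: "\<forall>j. \<forall>i\<ge>\<nu> $ j. coeff (A $ j) i = 0"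
    and orth: "\<forall>l. \<forall>j<\<mu> $ l. pairing l A (monom 1 j) = 0"
    and monic: "\<nu> $ k > 0" "coeff (A $ k) (\<nu> $ k - 1) = 1"
  shows "mop_II N t a b k \<nu> \<mu> = A"
proof -
  have mop: "is_mop N t a b \<nu> \<mu> B \<longleftrightarrow> B \<noteq> 0 \<and> (\<forall>j. \<forall>i\<ge>\<nu> $ j. coeff (B $ j) i = 0) \<and>
      (\<forall>l. \<forall>j<\<mu> $ l. pairing l B (monom 1 j) = 0)" for B
    using norm integral_mop_Q_eq_pairing[of B "monom 1 _"]
    by (simp add: is_mop_def degree_less_iff_coeff poly_monom flip: of_real_power)
  show ?thesis
    unfolding mop_II_def
  proof (rule the_equality)
    have "A $ k \<noteq> 0" using monic by auto
    then have "A \<noteq> 0" by auto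
    have "degree (A $ k) < \<nu> $ k"
      using deg \<open>A $ k \<noteq> 0\<close> degree_less_iff_coeff[of "A $ k" "\<nu> $ k"] by auto
    moreover have "degree (A $ k) \<ge> \<nu> $ k - 1" using monic by (intro le_degree) simp
    ultimately have "degree (A $ k) = \<nu> $ k - 1" by simp
    with \<open>A \<noteq> 0\<close> deg orth monic
    show "is_mop N t a b \<nu> \<mu> A \<and> degree (A $ k) + 1 = \<nu> $ k \<and> lead_coeff (A $ k) = 1"
      by (simp add: mop)
  next
    fix B assume B: "is_mop N t a b \<nu> \<mu> B \<and> degree (B $ k) + 1 = \<nu> $ k \<and> lead_coeff (B $ k) = 1"
    then have Bk: "coeff (B $ k) (\<nu> $ k - 1) = 1" by (metis add_diff_cancel_right')
    have "B - A = 0"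
    proof (rule orthogonal_eq_0[of "\<nu> - axis k 1" _ \<mu>])
      show "\<forall>j. \<forall>i\<ge>(\<nu> - axis k 1) $ j. coeff ((B - A) $ j) i = 0"
      proof (intro allI impI)
        fix j i assume i: "i \<ge> (\<nu> - axis k 1) $ j"
        show "coeff ((B - A) $ j) i = 0"
        proof (cases "i \<ge> \<nu> $ j")
          case True
          then show ?thesis using deg B by (simp add: mop)
        next
          case False
          with i have "j = k" "i = \<nu> $ k - 1" by (auto simp: axis_def split: if_splits)
          then show ?thesis using Bk monic by simp
        qed
      qed
      show "(\<nu> - axis k 1) $ 1 + (\<nu> - axis k 1) $ 2 \<le> \<mu> $ 1 + \<mu> $ 2"
        using norm monic(1) exhaust_2[of k] by (auto simp: axis_def)
      show "\<forall>l. \<forall>j<\<mu> $ l. pairing l (B - A) (monom 1 j) = 0"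
        using orth B by (simp add: mop pairing_diff_left)
    qed
    then show "B = A" by simp
  qed
qed

text \<open>
  For \<open>A\<close> of index \<open>n + e\<^sub>k\<close> the degree bounds of this vector are those of index \<open>n\<close>: the top degree
  of component \<open>k\<close> is lowered by differentiation, and there the second summand vanishes.
\<close>
definition lowered :: "2 \<Rightarrow> complex poly ^ 2 \<Rightarrow> complex poly ^ 2" where
  "lowered k A =
     (\<chi> j. smult (1 / \<kappa>) (pderiv (A $ j)) + smult (of_real ((1 - t) * (a $ j - a $ k))) (A $ j))"

text \<open>
  Integration by parts in component \<open>j\<close> produces the factor \<open>x - s\<^sub>j\<^sub>l\<close>; the multiple of \<open>A\<^sub>j\<close> in \<open>lowered\<close>
  moves its centre to \<open>s\<^sub>k\<^sub>l\<close>, the same for all components.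
\<close>
lemma pairing_lowered:
  "pairing l (lowered k A) r =
     pairing l A ([:- of_real (center k l), 1:] * r) - 1 / \<kappa> * pairing l A (pderiv r)"
proof -
  have "gauss_int \<kappa> (center j l) (lowered k A $ j * r) =
    gauss_int \<kappa> (center j l) (A $ j * ([:- of_real (center k l), 1:] * r))
     - 1 / \<kappa> * gauss_int \<kappa> (center j l) (A $ j * pderiv r)" for j
  proof -
    let ?g = "gauss_int \<kappa> (center j l)"
    have "?g (pderiv (A $ j) * r) + ?g (A $ j * pderiv r) = \<kappa> * ?g ([:- of_real (center j l), 1:] * (A $ j * r))"
      using gauss_int_pderiv[OF \<kappa>_pos, of "center j l" "A $ j * r"]
      by (simp add: pderiv_mult gauss_int_add[OF \<kappa>_pos] mult.commute add.commute)
    then have parts: "1 / \<kappa> * ?g (pderiv (A $ j) * r) + 1 / \<kappa> * ?g (A $ j * pderiv r)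
        = ?g ([:- of_real (center j l), 1:] * (A $ j * r))"
      using \<kappa>_pos by (simp add: field_simps)
    have "A $ j * ([:- of_real (center k l), 1:] * r) =
        [:- of_real (center j l), 1:] * (A $ j * r) + smult (of_real ((1 - t) * (a $ j - a $ k))) (A $ j * r)"
      by (simp add: center_def algebra_simps smult_add_left smult_diff_left)
    moreover have "lowered k A $ j * r = smult (1 / \<kappa>) (pderiv (A $ j) * r)
        + smult (of_real ((1 - t) * (a $ j - a $ k))) (A $ j * r)"
      by (simp add: lowered_def distrib_right)
    ultimately show ?thesis
      using parts by (simp only: gauss_int_add[OF \<kappa>_pos] gauss_int_smult) (simp add: algebra_simps)
  qed
  then show ?thesis
    by (simp add: pairing_def sum_subtractf sum_distrib_left)
qed

text \<open>
  The recurrence, stated for the four vectors \<open>U 1\<close>, \<open>U 2\<close>, \<open>V 1\<close>, \<open>V 2\<close> formed by the rows of the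
  Riemann--Hilbert matrix. Here \<open>cU\<close> and \<open>cV\<close> are subleading and leading coefficients,
  and \<open>w d\<close> are the first nonvanishing moments; \<open>w = - 2 \<pi> \<i>\<close> in the application. Taking \<open>k' \<noteq> k\<close> and \<open>l' \<noteq> l\<close> as
  parameters covers all four relations at once.
\<close>
lemma nearest_neighbour_recurrence:
  fixes n m :: "nat ^ 2" and U V :: "2 \<Rightarrow> complex poly ^ 2"
    and cU d cV :: "2 \<Rightarrow> 2 \<Rightarrow> complex" and w :: complex and k k' l l' :: 2
  assumes pos: "\<forall>k. n $ k > 0" "\<forall>l. m $ l > 0" and nm: "n $ 1 + n $ 2 = m $ 1 + m $ 2"
    and kk': "k \<noteq> k'" and ll': "l \<noteq> l'"
    and U_deg: "\<And>k j i. i \<ge> n $ j \<Longrightarrow> coeff (U k $ j) i = (if i = n $ j \<and> k = j then 1 else 0)"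
    and U_coeff: "\<And>k j. k \<noteq> j \<Longrightarrow> coeff (U k $ j) (n $ j - 1) = cU k j"
    and V_deg: "\<And>l j i. i \<ge> n $ j \<Longrightarrow> coeff (V l $ j) i = 0"
    and V_coeff: "\<And>l j. coeff (V l $ j) (n $ j - 1) = cV l j"
    and U_orth: "\<And>k l i. i < m $ l \<Longrightarrow> pairing l (U k) (monom 1 i) = 0"
    and U_pairing: "\<And>k l. pairing l (U k) (monom 1 (m $ l)) = w * d k l"
    and V_pairing: "\<And>l l' i. i < m $ l' \<Longrightarrow>
        pairing l' (V l) (monom 1 i) = (if l = l' \<and> i = m $ l' - 1 then w else 0)"
    and w: "w \<noteq> 0"
  shows "poly (mop_II N t a b k (n + 2 *s axis k 1) (m + axis l 1) $ k) z =
      (z - of_real (center k l) + cU k k' * d k' l / d k l) * poly (mop_II N t a b k (n + axis k 1) m $ k) z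
      - cU k k' * cU k' k * poly (mop_II N t a b k (n + axis k' 1) m $ k) z
      - d k l * cV l k * poly (mop_II N t a b k n (m - axis l 1) $ k) z
      - d k l' * cV l' k * poly (mop_II N t a b k n (m - axis l' 1) $ k) z"
proof -
  have total: "n $ k + n $ k' = n $ 1 + n $ 2" "m $ l + m $ l' = m $ 1 + m $ 2"
    using sum_two_indices[OF kk', of "\<lambda>k. n $ k"] sum_two_indices[OF ll', of "\<lambda>k. m $ k"]
    by (simp_all add: sum_2)
  have sum_vec: "v $ 1 + v $ 2 = v $ k + v $ k'" "v $ 1 + v $ 2 = v $ l + v $ l'" for v :: "nat ^ 2"
    using sum_two_indices[OF kk', of "\<lambda>k. v $ k"] sum_two_indices[OF ll', of "\<lambda>k. v $ k"]
    by (simp_all add: sum_2)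
  have total': "n $ k + n $ k' = m $ l + m $ l'" using total nm by simp
  have jk: "j = k \<or> j = k'" for j by (rule two_index_cases[OF kk'])
  have jl: "j = l \<or> j = l'" for j by (rule two_index_cases[OF ll'])
  have U_nz: "U j \<noteq> 0" for j
    using U_deg[of j "n $ j" j] by auto
  have V_nz: "V j \<noteq> 0" for j
    using V_pairing[of "m $ j - 1" j j] pos(2) w by (auto simp: pairing_def)

  \<comment> \<open>if one of these constants vanished, a nonzero vector would satisfy one condition too many or have
     one free coefficient too few\<close>
  have d_nz: "d k l \<noteq> 0"
  proof
    assume "d k l = 0"
    have "U k = 0"
    proof (rule orthogonal_eq_0[of "n + axis k 1" _ "m + axis l 1"])
      show "\<forall>j. \<forall>i\<ge>(n + axis k 1) $ j. coeff (U k $ j) i = 0"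
        using U_deg[of _ _ k] by (auto simp: axis_def)
      show "(n + axis k 1) $ 1 + (n + axis k 1) $ 2 \<le> (m + axis l 1) $ 1 + (m + axis l 1) $ 2"
        unfolding sum_vec(1)[of "n + _"] sum_vec(2)[of "m + _"] using total' kk' ll' by (simp add: axis_def)
      show "\<forall>j. \<forall>i<(m + axis l 1) $ j. pairing j (U k) (monom 1 i) = 0"
        using U_orth[of _ _ k] U_pairing[of l k] \<open>d k l = 0\<close> by (auto simp: axis_def less_Suc_eq)
    qed
    with U_nz show False by blast
  qed
  have cU_nz: "cU k' k \<noteq> 0"
  proof
    assume "cU k' k = 0"
    have "U k' = 0"
    proof (rule orthogonal_eq_0[of "n + axis k' 1 - axis k 1" _ m])
      show "\<forall>j. \<forall>i\<ge>(n + axis k' 1 - axis k 1) $ j. coeff (U k' $ j) i = 0"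
      proof (intro allI impI)
        fix j i assume i: "i \<ge> (n + axis k' 1 - axis k 1) $ j"
        show "coeff (U k' $ j) i = 0"
        proof (cases "i \<ge> n $ j")
          case True
          then show ?thesis using U_deg[of j i k'] i kk' by (auto simp: axis_def)
        next
          case False
          with i jk[of j] kk' have "j = k" "i = n $ k - 1" by (auto simp: axis_def split: if_splits)
          then show ?thesis using U_coeff[of k' k] kk' \<open>cU k' k = 0\<close> by simp
        qed
      qed
      show "(n + axis k' 1 - axis k 1) $ 1 + (n + axis k' 1 - axis k 1) $ 2 \<le> m $ 1 + m $ 2"
        unfolding sum_vec(1)[of "n + _ - _"] sum_vec(2)[of "m"] using total' kk' pos(1)[rule_format, of k]
        by (simp add: axis_def)
    qed (use U_orth in auto)
    with U_nz show False by blast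
  qed
  have cV_nz: "cV j k \<noteq> 0" for j
  proof
    assume "cV j k = 0"
    have "V j = 0"
    proof (rule orthogonal_eq_0[of "n - axis k 1" _ "m - axis j 1"])
      show "\<forall>h. \<forall>i\<ge>(n - axis k 1) $ h. coeff (V j $ h) i = 0"
      proof (intro allI impI)
        fix h i assume i: "i \<ge> (n - axis k 1) $ h"
        show "coeff (V j $ h) i = 0"
        proof (cases "i \<ge> n $ h")
          case True
          then show ?thesis using V_deg by simp
        next
          case False
          with i have "h = k" "i = n $ k - 1" by (auto simp: axis_def split: if_splits)
          then show ?thesis using V_coeff[of j k] \<open>cV j k = 0\<close> by simp
        qed
      qed
      show "(n - axis k 1) $ 1 + (n - axis k 1) $ 2 \<le> (m - axis j 1) $ 1 + (m - axis j 1) $ 2"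
        unfolding sum_vec(1)[of "n - _"] sum_vec(2)[of "m - _"]
        using total' kk' ll' pos(1)[rule_format, of k] pos(2)[rule_format, of l]
          pos(2)[rule_format, of l'] jl[of j] by (auto simp: axis_def)
      show "\<forall>h. \<forall>i<(m - axis j 1) $ h. pairing h (V j) (monom 1 i) = 0"
        using V_pairing by (auto simp: axis_def split: if_splits)
    qed
    with V_nz show False by blast
  qed

  \<comment> \<open>normalizing the four rows gives the four vectors on the right-hand side\<close>
  have mop_U: "mop_II N t a b k (n + axis k 1) m = U k"
  proof (rule mop_II_eqI)
    show "(n + axis k 1) $ 1 + (n + axis k 1) $ 2 = m $ 1 + m $ 2 + 1"
      unfolding sum_vec(1)[of "n + _"] sum_vec(2)[of "m"] using total' kk' by (simp add: axis_def)
  qed (use U_deg[of _ _ k] U_orth[of _ _ k] in \<open>auto simp: axis_def\<close>)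
  have mop_U': "mop_II N t a b k (n + axis k' 1) m = (\<chi> j. smult (1 / cU k' k) (U k' $ j))"
  proof (rule mop_II_eqI)
    show "(n + axis k' 1) $ 1 + (n + axis k' 1) $ 2 = m $ 1 + m $ 2 + 1"
      unfolding sum_vec(1)[of "n + _"] sum_vec(2)[of "m"] using total' kk' by (simp add: axis_def)
  qed (use U_deg[of _ _ k'] U_orth[of _ _ k'] U_coeff[of k' k] cU_nz kk' pos in
        \<open>auto simp: axis_def pairing_smult_left\<close>)
  have mop_V: "mop_II N t a b k n (m - axis j 1) = (\<chi> h. smult (1 / cV j k) (V j $ h))" for j
  proof (rule mop_II_eqI)
    show "n $ 1 + n $ 2 = (m - axis j 1) $ 1 + (m - axis j 1) $ 2 + 1"
      unfolding sum_vec(1)[of "n"] sum_vec(2)[of "m - _"]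
        using total' ll' pos(2)[rule_format, of l] pos(2)[rule_format, of l'] jl[of j] by (auto simp: axis_def)
    show "\<forall>h. \<forall>i<(m - axis j 1) $ h. pairing h (\<chi> h. smult (1 / cV j k) (V j $ h)) (monom 1 i) = 0"
      using V_pairing by (auto simp: axis_def pairing_smult_left split: if_splits)
  qed (use V_deg[of _ _ j] V_coeff[of j k] cV_nz[of j] pos in \<open>auto simp: axis_def\<close>)

  have shift: "[:x, 1:] * monom 1 i = monom 1 (Suc i) + smult x (monom 1 i)" for x :: complex and i
    by (simp add: monom_Suc smult_monom)
  have low: "pairing h (lowered k (U k)) (monom 1 i) = pairing h (U k) (monom 1 (Suc i))
      - center k h * pairing h (U k) (monom 1 i)
      - i / \<kappa> * pairing h (U k) (monom 1 (i - 1))" for h i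
  proof -
    have "pderiv (monom 1 i) = smult (of_nat i) (monom 1 (i - 1) :: complex poly)"
      by (simp add: pderiv_monom smult_monom)
    then show ?thesis
      unfolding pairing_lowered shift by (simp add: pairing_add_right pairing_diff_right pairing_smult_right)
  qed
  have low_deg: "coeff (lowered k (U k) $ j) i = 0" if "i \<ge> n $ j" for i j
    using U_deg[of j i k] U_deg[of j "Suc i" k] that
    by (auto simp: lowered_def coeff_pderiv)

  \<comment> \<open>\<open>lowered k (U k)\<close> has the degrees of index \<open>n\<close> and pairs to zero except with the top powers
     \<open>x ^ (m $ l - 1)\<close>; the two vectors \<open>V\<close> are dual to these, so subtracting them leaves \<open>0\<close>\<close>
  define D where "D = lowered k (U k) - (\<chi> j. smult (d k l) (V l $ j)) - (\<chi> j. smult (d k l') (V l' $ j))"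
  have "D = 0"
  proof (rule orthogonal_eq_0[of n _ m])
    show "\<forall>j. \<forall>i\<ge>n $ j. coeff (D $ j) i = 0"
      by (auto simp: D_def low_deg V_deg)
    show "\<forall>h. \<forall>i<m $ h. pairing h D (monom 1 i) = 0"
    proof (intro allI impI)
      fix h i assume i: "i < m $ h"
      then have "pairing h (U k) (monom 1 (Suc i)) = (if i = m $ h - 1 then w * d k h else 0)"
        using U_pairing[of h k] U_orth[of "Suc i" h k] by auto
      then show "pairing h D (monom 1 i) = 0"
        using i jl[of h] ll' unfolding D_def
        by (auto simp: pairing_diff_left pairing_smult_left low U_orth V_pairing)
    qed
  qed (use nm in simp)
  then have low_eq: "lowered k (U k) $ k = smult (d k l) (V l $ k) + smult (d k l') (V l' $ k)"
    by (simp add: D_def vec_eq_iff algebra_simps)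

  \<comment> \<open>in component \<open>k'\<close> the leading terms of \<open>z U\<close> and \<open>cU k k' U'\<close> cancel; \<open>g\<close> is determined by the
     extra condition against \<open>x ^ (m $ l)\<close>\<close>
  define g where "g = - of_real (center k l) + cU k k' * d k' l / d k l"
  define X where "X = (\<chi> j. [:g, 1:] * U k $ j) - (\<chi> j. smult (cU k k') (U k' $ j)) - lowered k (U k)"
  have "mop_II N t a b k (n + 2 *s axis k 1) (m + axis l 1) = X"
  proof (rule mop_II_eqI)
    show "(n + 2 *s axis k 1) $ 1 + (n + 2 *s axis k 1) $ 2 = (m + axis l 1) $ 1 + (m + axis l 1) $ 2 + 1"
      unfolding sum_vec(1)[of "n + _"] sum_vec(2)[of "m + _"] using total' kk' ll' by (simp add: axis_def)
    have coeff_X: "coeff (X $ j) (Suc i) = g * coeff (U k $ j) (Suc i) + coeff (U k $ j) i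
       - cU k k' * coeff (U k' $ j) (Suc i) - coeff (lowered k (U k) $ j) (Suc i)" for i j
      by (simp add: X_def)
    show "\<forall>j. \<forall>i\<ge>(n + 2 *s axis k 1) $ j. coeff (X $ j) i = 0"
    proof (intro allI impI)
      fix j i assume i: "i \<ge> (n + 2 *s axis k 1) $ j"
      then have ij: "i \<ge> n $ j" by simp
      then obtain i' where i': "i = Suc i'" using pos(1) by (metis Suc_pred less_le_trans)
      show "coeff (X $ j) i = 0"
      proof (cases "j = k")
        case True
        with i i' have "i' \<ge> Suc (n $ k)" by (simp add: axis_def)
        then show ?thesis
          unfolding i' coeff_X True by (simp add: U_deg low_deg)
      next
        case False
        with jk[of j] have j: "j = k'" by auto
        show ?thesis
        proof (cases "i = n $ k'")
          case True
          then have "i' = n $ k' - 1" using i' by simp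
          then have "coeff (U k $ k') i' = cU k k'" using U_coeff kk' by simp
          then show ?thesis
            unfolding i' coeff_X j using True i' kk' by (simp add: U_deg low_deg)
        next
          case False
          with ij i' j have "i' \<ge> n $ k'" "Suc i' > n $ k'" by auto
          then show ?thesis
            unfolding i' coeff_X j using kk' by (simp add: U_deg low_deg)
        qed
      qed
    qed
    show "(n + 2 *s axis k 1) $ k > 0" by (simp add: axis_def)
    have "(n + 2 *s axis k 1) $ k - 1 = Suc (n $ k)" by (simp add: axis_def)
    then show "coeff (X $ k) ((n + 2 *s axis k 1) $ k - 1) = 1"
      using kk' by (simp only: coeff_X) (simp add: U_deg low_deg)
    have pX: "pairing h X (monom 1 i) = (g + center k h) * pairing h (U k) (monom 1 i)
       - cU k k' * pairing h (U k') (monom 1 i) + i / \<kappa> * pairing h (U k) (monom 1 (i - 1))" for h i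
      unfolding X_def pairing_diff_left pairing_mult shift low pairing_smult_left
        pairing_add_right pairing_smult_right
      by (simp add: algebra_simps)
    show "\<forall>h. \<forall>i<(m + axis l 1) $ h. pairing h X (monom 1 i) = 0"
    proof (intro allI impI)
      fix h i assume i: "i < (m + axis l 1) $ h"
      show "pairing h X (monom 1 i) = 0"
      proof (cases "i < m $ h")
        case True
        then show ?thesis by (simp add: pX U_orth)
      next
        case False
        with i have hl: "h = l" "i = m $ l" by (auto simp: axis_def split: if_splits)
        have "pairing l (U k) (monom 1 (m $ l - 1)) = 0" using pos by (simp add: U_orth)
        then show ?thesis
          unfolding hl pX U_pairing using d_nz by (simp add: g_def)
      qed
    qed
  qed
  then show ?thesis
    unfolding mop_U mop_U' mop_V
    using cU_nz cV_nz by (simp only:) (simp add: X_def low_eq g_def algebra_simps)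
qed
end

section \<open>Columns of the Riemann--Hilbert matrix\<close>

text \<open>
  Growth of order \<open>n - 2\<close> on the imaginary axis already bounds the degree, so the estimate is needed only off
  the real line.
\<close>
lemma coeff_eq_0_if_small_off_reals:
  fixes q :: "complex poly"
  assumes small: "\<And>z. z \<notin> \<real> \<Longrightarrow> norm z \<ge> R \<Longrightarrow> norm (poly q z) \<le> K * norm z ^ n / norm z ^ 2"
    and "i \<ge> n - 1" "n > 0"
  shows "coeff q i = 0"
proof (rule ccontr)
  assume nz: "coeff q i \<noteq> 0"
  then have "degree q \<ge> i" by (rule le_degree)
  then have deg: "degree q \<ge> n - 1" using \<open>i \<ge> n - 1\<close> by simp
  let ?z = "\<lambda>y::real. \<i> * of_real y"
  have inf: "filterlim ?z at_infinity at_top"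
    by (rule filterlim_norm_at_top_imp_at_infinity)
       (simp add: norm_mult filterlim_abs_real)
  have "((\<lambda>y. poly q (?z y) / ?z y ^ degree q) \<longlongrightarrow> lead_coeff q) at_top"
    by (rule filterlim_compose[OF poly_divide_tendsto_aux inf])
  moreover have "((\<lambda>y. poly q (?z y) / ?z y ^ degree q) \<longlongrightarrow> 0) at_top"
  proof (rule Lim_null_comparison)
    show "\<forall>\<^sub>F y in at_top. norm (poly q (?z y) / ?z y ^ degree q) \<le> \<bar>K\<bar> / y"
      using eventually_ge_at_top[of "max 1 R"]
    proof eventually_elim
      case (elim y)
      then have y: "y \<ge> 1" "y \<ge> R" by auto
      have "norm (poly q (?z y)) \<le> K * y ^ n / y ^ 2"
        using small[of "?z y"] y by (simp add: norm_mult complex_is_Real_iff)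
      also have "\<dots> \<le> \<bar>K\<bar> * y ^ n / y ^ 2"
        using y by (intro divide_right_mono mult_right_mono) auto
      finally have le: "norm (poly q (?z y)) \<le> \<bar>K\<bar> * y ^ n / y ^ 2" .
      have "norm (poly q (?z y) / ?z y ^ degree q) = norm (poly q (?z y)) / y ^ degree q"
        using y by (simp add: norm_divide norm_power norm_mult)
      also have "\<dots> \<le> \<bar>K\<bar> * y ^ n / y ^ 2 / y ^ degree q"
        using y by (intro divide_right_mono[OF le]) simp
      also have "\<dots> = \<bar>K\<bar> / y * (y ^ n / y ^ Suc (degree q))"
        using y by (simp add: field_simps power2_eq_square)
      also have "\<dots> \<le> \<bar>K\<bar> / y * 1"
      proof (intro mult_left_mono)
        have "y ^ n \<le> y ^ Suc (degree q)" using y deg by (intro power_increasing) auto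
        then show "y ^ n / y ^ Suc (degree q) \<le> 1" using y by (simp add: field_simps)
      qed (use y in auto)
      finally show ?case by simp
    qed
    show "((\<lambda>y. \<bar>K\<bar> / y) \<longlongrightarrow> 0) at_top"
      by (intro tendsto_divide_0[OF tendsto_const] filterlim_at_top_imp_at_infinity filterlim_ident)
  qed
  ultimately have "lead_coeff q = 0" by (rule tendsto_unique[OF trivial_limit_at_top_linorder])
  with nz show False by simp
qed

lemma polynomial_column:
  fixes f :: "complex \<Rightarrow> complex"
  assumes hol: "f holomorphic_on - \<real>"
    and upper: "\<And>x. (f \<longlongrightarrow> g x) (at (of_real x) within {z. Im z > 0})"
    and lower: "\<And>x. (f \<longlongrightarrow> g x) (at (of_real x) within {z. Im z < 0})"
    and asy: "\<And>z. z \<notin> \<real> \<Longrightarrow> norm z \<ge> R \<Longrightarrow>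
      \<exists>\<epsilon>. f z = (\<delta> + c / z + \<epsilon>) * z ^ n \<and> norm \<epsilon> \<le> K / norm z ^ 2"
    and "n > 0"
  obtains p where "\<And>x. g x = poly p (of_real x)"
    "\<And>i. i \<ge> n - 1 \<Longrightarrow> coeff p i = (if i = n then \<delta> else if i = n - 1 then c else 0)"
proof -
  let ?R = "max 1 R"
  have bound: "norm (f z) \<le> (norm \<delta> + norm c + \<bar>K\<bar>) * norm z ^ n" if z: "z \<notin> \<real>" "norm z \<ge> ?R" for z
  proof -
    have z1: "norm z \<ge> 1" "norm z \<ge> R" using z by auto
    obtain \<epsilon> where \<epsilon>: "f z = (\<delta> + c / z + \<epsilon>) * z ^ n" "norm \<epsilon> \<le> K / norm z ^ 2"
      using asy[OF z(1) z1(2)] by blast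
    have "norm (c / z) \<le> norm c" using z1 by (simp add: norm_divide divide_le_eq mult_left_le_one_le mult_le_cancel_left1)
    moreover have "norm \<epsilon> \<le> \<bar>K\<bar>"
    proof -
      have "K / norm z ^ 2 \<le> \<bar>K\<bar> / 1"
        by (rule frac_le) (use z1 one_le_power in auto)
      with \<epsilon>(2) show ?thesis by simp
    qed
    ultimately have "norm (\<delta> + c / z + \<epsilon>) \<le> norm \<delta> + norm c + \<bar>K\<bar>"
      using norm_triangle_ineq[of "\<delta> + c / z" \<epsilon>] norm_triangle_ineq[of \<delta> "c / z"] by linarith
    then show ?thesis unfolding \<epsilon>(1) norm_mult norm_power by (rule mult_right_mono) simp
  qed
  obtain p where p: "\<And>z. z \<notin> \<real> \<Longrightarrow> f z = poly p z" "\<And>x. g x = poly p (of_real x)"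
    using polynomial_if_no_jump[OF hol upper lower bound] by metis
  define q where "q = p - monom \<delta> n - monom c (n - 1)"
  have "coeff q i = 0" if "i \<ge> n - 1" for i
  proof (rule coeff_eq_0_if_small_off_reals[OF _ that \<open>n > 0\<close>])
    fix z :: complex assume z: "z \<notin> \<real>" "norm z \<ge> R"
    then have "z \<noteq> 0" by auto
    obtain \<epsilon> where \<epsilon>: "f z = (\<delta> + c / z + \<epsilon>) * z ^ n" "norm \<epsilon> \<le> K / norm z ^ 2"
      using asy[OF z] by blast
    obtain n' where "n = Suc n'" using \<open>n > 0\<close> by (cases n) auto
    then have "(\<delta> + c / z + \<epsilon>) * z ^ n = \<delta> * z ^ n + c * z ^ (n - 1) + \<epsilon> * z ^ n"
      using \<open>z \<noteq> 0\<close> by (simp add: field_simps)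
    then have "poly q z = \<epsilon> * z ^ n"
      using \<epsilon>(1) p(1)[OF z(1)] by (simp add: q_def poly_monom)
    then show "norm (poly q z) \<le> K * norm z ^ n / norm z ^ 2"
      using mult_right_mono[OF \<epsilon>(2), of "norm z ^ n"] by (simp add: norm_mult norm_power)
  qed
  then have "coeff p i = (if i = n then \<delta> else if i = n - 1 then c else 0)" if "i \<ge> n - 1" for i
  proof -
    have "coeff q i = coeff p i - (if n = i then \<delta> else 0) - (if n - 1 = i then c else 0)"
      by (simp add: q_def)
    with \<open>\<And>i. i \<ge> n - 1 \<Longrightarrow> coeff q i = 0\<close>[OF that] \<open>n > 0\<close> show ?thesis
      by (auto split: if_splits)
  qed
  with p(2) show ?thesis by (rule that)
qed

text \<open>
  Multiplying by \<open>z ^ j\<close> moves the expansion so that its coefficient of \<open>1 / z\<close> is \<open>0\<close> for \<open>j + 1 < m\<close>, then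
  \<open>\<delta>\<close>, then \<open>c\<close>. For \<open>j = m\<close> a nonzero \<open>\<delta>\<close> would be a constant term and prevent decay.
\<close>
lemma jump_column_integral:
  fixes f :: "complex \<Rightarrow> complex"
  assumes hol: "f holomorphic_on - \<real>"
    and upper: "\<And>x. (f \<longlongrightarrow> u x) (at (of_real x) within {z. Im z > 0})"
    and lower: "\<And>x. (f \<longlongrightarrow> v x) (at (of_real x) within {z. Im z < 0})"
    and asy: "\<And>z. z \<notin> \<real> \<Longrightarrow> norm z \<ge> R \<Longrightarrow>
      \<exists>\<epsilon>. f z = (\<delta> + c / z + \<epsilon>) * z powi - int m \<and> norm \<epsilon> \<le> K / norm z ^ 2"
    and int: "integrable lborel (\<lambda>x. (u x - v x) * of_real x ^ j)"
    and j: "j \<le> m" "j = m \<Longrightarrow> \<delta> = 0"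
  shows "(\<integral>x. (u x - v x) * of_real x ^ j \<partial>lborel)
    = - 2 * pi * \<i> * (if j = m then c else if Suc j = m then \<delta> else 0)"
proof -
  let ?\<tau> = "if j = m then c else if Suc j = m then \<delta> else 0"
  let ?f = "\<lambda>z. f z * z ^ j"
  have "(\<integral>x. u x * of_real x ^ j - v x * of_real x ^ j \<partial>lborel) = - 2 * pi * \<i> * ?\<tau>"
  proof (rule boundary_jump_integral[where f = ?f and R\<^sub>0 = "max 1 R" and K = "norm \<delta> + norm c + \<bar>K\<bar>"])
    show "?f holomorphic_on - \<real>" by (intro holomorphic_intros hol)
    fix x
    show "(?f \<longlongrightarrow> u x * of_real x ^ j) (at (of_real x) within {z. Im z > 0})"
      by (intro tendsto_intros upper)
    show "(?f \<longlongrightarrow> v x * of_real x ^ j) (at (of_real x) within {z. Im z < 0})"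
      by (intro tendsto_intros lower)
  next
    fix z :: complex assume z: "z \<notin> \<real>" "norm z \<ge> max 1 R"
    then have z1: "norm z \<ge> 1" "norm z \<ge> R" and "z \<noteq> 0" by auto
    obtain \<epsilon> where \<epsilon>: "f z = (\<delta> + c / z + \<epsilon>) * z powi - int m" "norm \<epsilon> \<le> K / norm z ^ 2"
      using asy[OF z(1) z1(2)] by blast
    obtain k where k: "m = j + k" using j(1) le_Suc_ex by blast
    have "z powi - int m = inverse (z ^ m)" by (simp add: power_int_minus)
    also have "\<dots> * z ^ j = 1 / z ^ k"
      using \<open>z \<noteq> 0\<close> by (simp add: k power_add field_simps)
    finally have fz: "f z * z ^ j = (\<delta> + c / z + \<epsilon>) / z ^ k"
      unfolding \<epsilon>(1) by (simp only: mult.assoc times_divide_eq_right mult_1_right)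
    have ze: "norm (z ^ 2 * \<epsilon>) \<le> \<bar>K\<bar>"
    proof -
      have "norm (z ^ 2 * \<epsilon>) \<le> norm z ^ 2 * (K / norm z ^ 2)"
        unfolding norm_mult norm_power by (intro mult_left_mono \<epsilon>(2)) simp
      with \<open>z \<noteq> 0\<close> show ?thesis by simp
    qed
    have e1: "norm \<epsilon> \<le> \<bar>K\<bar>" "norm (z * \<epsilon>) \<le> \<bar>K\<bar>"
    proof -
      have "1 \<le> norm z ^ 2" using z1 by simp
      moreover have "norm z \<le> norm z ^ 2"
        using z1 mult_left_mono[of 1 "norm z" "norm z"] by (simp add: power2_eq_square)
      ultimately have "1 * norm \<epsilon> \<le> norm z ^ 2 * norm \<epsilon>" "norm z * norm \<epsilon> \<le> norm z ^ 2 * norm \<epsilon>"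
        by (intro mult_right_mono; simp)+
      with ze show "norm \<epsilon> \<le> \<bar>K\<bar>" "norm (z * \<epsilon>) \<le> \<bar>K\<bar>"
        by (auto simp: norm_mult norm_power)
    qed
    have "norm (z ^ 2 * (f z * z ^ j - ?\<tau> / z)) \<le> norm \<delta> + norm c + \<bar>K\<bar>"
    proof -
      consider "k = 0" | "k = 1" | k' where "k = Suc (Suc k')" by (metis One_nat_def not0_implies_Suc)
      then show ?thesis
      proof cases
        case 1
        then have eq: "z ^ 2 * (f z * z ^ j - ?\<tau> / z) = z ^ 2 * \<epsilon>"
          using j(2) by (simp add: fz k)
        show ?thesis
          unfolding eq using ze norm_ge_zero[of \<delta>] norm_ge_zero[of c] by linarith
      next
        case 2
        then have eq: "z ^ 2 * (f z * z ^ j - ?\<tau> / z) = c + z * \<epsilon>"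
          using \<open>z \<noteq> 0\<close> by (simp add: fz k field_simps power2_eq_square)
        show ?thesis
          unfolding eq using e1(2) norm_triangle_ineq[of c "z * \<epsilon>"] norm_ge_zero[of \<delta>] by linarith
      next
        case 3
        then have eq: "z ^ 2 * (f z * z ^ j - ?\<tau> / z) = (\<delta> + c / z + \<epsilon>) / z ^ k'"
          using \<open>z \<noteq> 0\<close> by (simp add: fz k field_simps power2_eq_square)
        have "norm ((\<delta> + c / z + \<epsilon>) / z ^ k') \<le> norm (\<delta> + c / z + \<epsilon>) / 1"
          unfolding norm_divide norm_power
          by (intro divide_left_mono) (use z1 \<open>z \<noteq> 0\<close> in \<open>auto intro: one_le_power\<close>)
        moreover have "norm (c / z) \<le> norm c"
          using z1 by (simp add: norm_divide divide_le_eq mult_le_cancel_left1)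
        ultimately show ?thesis
          unfolding eq using e1(1) norm_triangle_ineq[of "\<delta> + c / z" \<epsilon>] norm_triangle_ineq[of \<delta> "c / z"] by simp
      qed
    qed
    then have "norm z ^ 2 * norm (f z * z ^ j - ?\<tau> / z) \<le> norm \<delta> + norm c + \<bar>K\<bar>"
      unfolding norm_mult[of "z ^ 2"] norm_power .
    moreover have "norm z ^ 2 > 0" using \<open>z \<noteq> 0\<close> by simp
    ultimately show "norm (f z * z ^ j - ?\<tau> / z) \<le> (norm \<delta> + norm c + \<bar>K\<bar>) / norm z ^ 2"
      by (simp only: pos_le_divide_eq mult.commute)
  next
    show "integrable lborel (\<lambda>x. u x * of_real x ^ j - v x * of_real x ^ j)"
      using int by (simp add: left_diff_distrib)
  qed
  then show ?thesis by (simp add: left_diff_distrib)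
qed

text \<open>
  Rows and columns of the matrix are indexed by the two weights \<open>w\<^sub>1\<^sub>k\<close> followed by the two weights
  \<open>w\<^sub>2\<^sub>l\<close>.
\<close>
definition left_col :: "2 \<Rightarrow> 4" where "left_col k = (if k = 1 then 1 else 2)"
definition right_col :: "2 \<Rightarrow> 4" where "right_col l = (if l = 1 then 3 else 4)"

lemma left_col_eq_iff [simp]: "left_col k = left_col j \<longleftrightarrow> k = j"
  using exhaust_2[of k] exhaust_2[of j] by (auto simp: left_col_def)

lemma right_col_eq_iff [simp]: "right_col k = right_col j \<longleftrightarrow> k = j"
  using exhaust_2[of k] exhaust_2[of j] by (auto simp: right_col_def)

lemma left_col_neq_right_col [simp]: "left_col k \<noteq> right_col j" "right_col j \<noteq> left_col k"
  by (auto simp: left_col_def right_col_def)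

lemma vector_4:
  fixes w x y z :: "'a::zero"
  shows "(vector [w, x, y, z] :: 'a ^ 4) $ 1 = w" "(vector [w, x, y, z] :: 'a ^ 4) $ 2 = x"
    "(vector [w, x, y, z] :: 'a ^ 4) $ 3 = y" "(vector [w, x, y, z] :: 'a ^ 4) $ 4 = z"
  unfolding vector_def by simp_all

lemma matrix_mult_jump:
  fixes M :: "complex ^ 4 ^ 4"
  shows "(M ** jump N t a b x) $ i $ left_col k = M $ i $ left_col k"
    and "(M ** jump N t a b x) $ i $ right_col l = M $ i $ right_col l
      + (\<Sum>k\<in>UNIV. M $ i $ left_col k * of_real (w1 N t a k x * w2 N t b l x))"
  using exhaust_2[of k] exhaust_2[of l]
  by (auto simp: matrix_matrix_mult_def sum_4 sum_2 jump_def Let_def left_col_def right_col_def vector_4)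

lemma matrix_mult_asymp_diag:
  fixes M :: "complex ^ 4 ^ 4"
  shows "(M ** asymp_diag n m z) $ i $ left_col k = M $ i $ left_col k * z ^ (n $ k)"
    and "(M ** asymp_diag n m z) $ i $ right_col l = M $ i $ right_col l * z powi - int (m $ l)"
  using exhaust_2[of k] exhaust_2[of l]
  by (auto simp: matrix_matrix_mult_def sum_4 asymp_diag_def Let_def left_col_def right_col_def vector_4)

lemma RHP_entry_asymptotics:
  assumes "is_RHP_solution N t a b n m Y c"
  obtains R K where "\<And>z. z \<notin> \<real> \<Longrightarrow> norm z \<ge> R \<Longrightarrow> \<exists>M :: complex ^ 4 ^ 4. Y z = M ** asymp_diag n m z \<and>
    (\<exists>\<epsilon>. M $ i $ j = (if i = j then 1 else 0) + c $ i $ j / z + \<epsilon> \<and> norm \<epsilon> \<le> K / norm z ^ 2)"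
proof -
  obtain E where E: "(\<lambda>z. E z $ i $ j) \<in> O[inf at_infinity (principal (- \<real>))](\<lambda>z. 1 / z^2)"
    and Y: "\<forall>z \<in> - \<real>. Y z = (mat 1 + (\<chi> i j. c $ i $ j / z) + E z) ** asymp_diag n m z"
    using assms unfolding is_RHP_solution_def by blast
  obtain K where "\<forall>\<^sub>F z in inf at_infinity (principal (- \<real>)). norm (E z $ i $ j) \<le> K * norm (1 / z^2)"
    using E by (elim landau_o.bigE) blast
  then obtain R where R: "\<And>z. norm z \<ge> R \<Longrightarrow> z \<notin> \<real> \<Longrightarrow> norm (E z $ i $ j) \<le> K * norm (1 / z^2)"
    by (auto simp: eventually_inf_principal eventually_at_infinity)
  show ?thesis
  proof (rule that[of R K])
    fix z :: complex assume z: "z \<notin> \<real>" "norm z \<ge> R"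
    then show "\<exists>M :: complex ^ 4 ^ 4. Y z = M ** asymp_diag n m z \<and>
      (\<exists>\<epsilon>. M $ i $ j = (if i = j then 1 else 0) + c $ i $ j / z + \<epsilon> \<and> norm \<epsilon> \<le> K / norm z ^ 2)"
      using Y R[OF z(2,1)]
      by (intro exI[of _ "mat 1 + (\<chi> i j. c $ i $ j / z) + E z"] conjI exI[of _ "E z $ i $ j"])
         (auto simp: mat_def norm_divide norm_power)
  qed
qed

context gaussian_weights
begin

text \<open>
  Everything that is needed from row \<open>i\<close> of \<open>Y\<close>: its left half consists of polynomials with prescribed
  top coefficients, and its right half prescribes their moments.
\<close>
lemma RHP_row_pairings:
  assumes pos: "\<forall>k. n $ k > 0" and rhp: "is_RHP_solution N t a b n m Y c"
  shows "\<exists>P :: complex poly ^ 2.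
    (\<forall>k h. h \<ge> n $ k - 1 \<longrightarrow> coeff (P $ k) h =
       (if h = n $ k then if i = left_col k then 1 else 0
        else if h = n $ k - 1 then c $ i $ left_col k else 0)) \<and>
    (\<forall>l h. h \<le> m $ l \<longrightarrow> (h = m $ l \<longrightarrow> i \<noteq> right_col l) \<longrightarrow> pairing l P (monom 1 h) =
       - 2 * pi * \<i> * (if h = m $ l then c $ i $ right_col l
          else if Suc h = m $ l \<and> i = right_col l then 1 else 0))"
proof -
  have hol: "(\<lambda>z. Y z $ i $ j) holomorphic_on - \<real>" for j
    using rhp unfolding is_RHP_solution_def by (blast intro: analytic_imp_holomorphic)
  obtain Yp Ym where Yp: "\<And>x. (Y \<longlongrightarrow> Yp x) (at (complex_of_real x) within {z. Im z > 0})"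
    and Ym: "\<And>x. (Y \<longlongrightarrow> Ym x) (at (complex_of_real x) within {z. Im z < 0})"
    and jump: "\<And>x. Yp x = Ym x ** jump N t a b x"
    using rhp unfolding is_RHP_solution_def by metis
  have upper: "((\<lambda>z. Y z $ i $ j) \<longlongrightarrow> Yp x $ i $ j) (at (of_real x) within {z. Im z > 0})"
    and lower: "((\<lambda>z. Y z $ i $ j) \<longlongrightarrow> Ym x $ i $ j) (at (of_real x) within {z. Im z < 0})" for x j
    by (intro tendsto_vec_nth Yp Ym)+
  have "\<exists>p. (\<forall>x. Ym x $ i $ left_col k = poly p (of_real x)) \<and>
      (\<forall>h\<ge>n $ k - 1. coeff p h = (if h = n $ k then if i = left_col k then 1 else 0
        else if h = n $ k - 1 then c $ i $ left_col k else 0))" for k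
  proof -
    obtain R K where RK: "\<And>z. z \<notin> \<real> \<Longrightarrow> norm z \<ge> R \<Longrightarrow> \<exists>M :: complex ^ 4 ^ 4. Y z = M ** asymp_diag n m z \<and>
        (\<exists>\<epsilon>. M $ i $ left_col k = (if i = left_col k then 1 else 0) + c $ i $ left_col k / z + \<epsilon>
          \<and> norm \<epsilon> \<le> K / norm z ^ 2)"
      using RHP_entry_asymptotics[OF rhp] by blast
    have asy: "\<exists>\<epsilon>. Y z $ i $ left_col k = ((if i = left_col k then 1 else 0) + c $ i $ left_col k / z + \<epsilon>) * z ^ (n $ k)
        \<and> norm \<epsilon> \<le> K / norm z ^ 2" if "z \<notin> \<real>" "norm z \<ge> R" for z
    proof -
      from RK[OF that] obtain M \<epsilon> where M: "Y z = M ** asymp_diag n m z"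
        "M $ i $ left_col k = (if i = left_col k then 1 else 0) + c $ i $ left_col k / z + \<epsilon>"
        "norm \<epsilon> \<le> K / norm z ^ 2" by blast
      show ?thesis
        unfolding M(1) matrix_mult_asymp_diag(1) M(2) using M(3) by blast
    qed
    have "Yp x $ i $ left_col k = Ym x $ i $ left_col k" for x
      unfolding jump matrix_mult_jump(1) ..
    then have upper': "((\<lambda>z. Y z $ i $ left_col k) \<longlongrightarrow> Ym x $ i $ left_col k)
        (at (of_real x) within {z. Im z > 0})" for x
      using upper[of "left_col k" x] by simp
    show ?thesis
      by (rule polynomial_column[OF hol upper' lower asy pos[rule_format]]) blast+
  qed
  then have "\<forall>k. \<exists>p. (\<forall>x. Ym x $ i $ left_col k = poly p (of_real x)) \<and>
      (\<forall>h\<ge>n $ k - 1. coeff p h = (if h = n $ k then if i = left_col k then 1 else 0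
        else if h = n $ k - 1 then c $ i $ left_col k else 0))"
    by blast
  from choice[OF this] obtain p where p: "\<And>k x. Ym x $ i $ left_col k = poly (p k) (of_real x)"
    "\<And>k h. h \<ge> n $ k - 1 \<Longrightarrow> coeff (p k) h = (if h = n $ k then if i = left_col k then 1 else 0
        else if h = n $ k - 1 then c $ i $ left_col k else 0)"
    by blast
  define P where "P = (\<chi> k. p k)"
  have diff: "(Yp x $ i $ right_col l - Ym x $ i $ right_col l) * of_real x ^ h
     = mop_Q N t a P x * poly (monom 1 h) (of_real x) * of_real (w2 N t b l x)" for x l h
    unfolding jump matrix_mult_jump(2)
    by (simp add: p P_def mop_Q_def sum_2 poly_monom algebra_simps)
  show ?thesis
  proof (intro exI[of _ P] conjI allI impI)
    fix l h assume h: "h \<le> m $ l" "h = m $ l \<longrightarrow> i \<noteq> right_col l"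
    obtain R K where RK: "\<And>z. z \<notin> \<real> \<Longrightarrow> norm z \<ge> R \<Longrightarrow> \<exists>M :: complex ^ 4 ^ 4. Y z = M ** asymp_diag n m z \<and>
        (\<exists>\<epsilon>. M $ i $ right_col l = (if i = right_col l then 1 else 0) + c $ i $ right_col l / z + \<epsilon>
          \<and> norm \<epsilon> \<le> K / norm z ^ 2)"
      using RHP_entry_asymptotics[OF rhp] by blast
    have asy: "\<exists>\<epsilon>. Y z $ i $ right_col l = ((if i = right_col l then 1 else 0) + c $ i $ right_col l / z + \<epsilon>)
          * z powi - int (m $ l) \<and> norm \<epsilon> \<le> K / norm z ^ 2" if "z \<notin> \<real>" "norm z \<ge> R" for z
    proof -
      from RK[OF that] obtain M \<epsilon> where M: "Y z = M ** asymp_diag n m z"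
        "M $ i $ right_col l = (if i = right_col l then 1 else 0) + c $ i $ right_col l / z + \<epsilon>"
        "norm \<epsilon> \<le> K / norm z ^ 2" by blast
      show ?thesis
        unfolding M(1) matrix_mult_asymp_diag(2) M(2) using M(3) by blast
    qed
    have "integrable lborel (\<lambda>x. (Yp x $ i $ right_col l - Ym x $ i $ right_col l) * of_real x ^ h)"
      unfolding diff mop_Q_mult_w2
      by (intro Bochner_Integration.integrable_sum integrable_poly_gauss_weight \<kappa>_pos)
    from jump_column_integral[OF hol upper lower asy this h(1)] h(2)
    have "(\<integral>x. (Yp x $ i $ right_col l - Ym x $ i $ right_col l) * of_real x ^ h \<partial>lborel) =
       - 2 * pi * \<i> * (if h = m $ l then c $ i $ right_col l
          else if Suc h = m $ l then if i = right_col l then 1 else 0 else 0)"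
      by simp
    then show "pairing l P (monom 1 h) = - 2 * pi * \<i> * (if h = m $ l then c $ i $ right_col l
          else if Suc h = m $ l \<and> i = right_col l then 1 else 0)"
      unfolding diff integral_mop_Q_eq_pairing by auto
  qed (auto simp: P_def p(2))
qed

text \<open>
  Rows \<open>left_col k\<close> serve as the vectors \<open>U k\<close> and rows \<open>right_col l\<close> as the vectors \<open>V l\<close>. The latter have
  lower degree but, because of the diagonal entry \<open>1\<close> of the leading term, one moment \<open>- 2 \<pi> \<i>\<close> already
  at the power \<open>m $ l - 1\<close>.
\<close>
lemma RHP_recurrence:
  assumes pos: "\<forall>k. n $ k > 0" "\<forall>l. m $ l > 0" and nm: "n $ 1 + n $ 2 = m $ 1 + m $ 2"
    and rhp: "is_RHP_solution N t a b n m Y c"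
    and kk': "k \<noteq> k'" and ll': "l \<noteq> l'"
  shows "poly (mop_II N t a b k (n + 2 *s axis k 1) (m + axis l 1) $ k) z =
      (z - of_real (center k l) + c $ left_col k $ left_col k' * c $ left_col k' $ right_col l
          / c $ left_col k $ right_col l) * poly (mop_II N t a b k (n + axis k 1) m $ k) z
      - c $ left_col k $ left_col k' * c $ left_col k' $ left_col k
          * poly (mop_II N t a b k (n + axis k' 1) m $ k) z
      - c $ left_col k $ right_col l * c $ right_col l $ left_col k
          * poly (mop_II N t a b k n (m - axis l 1) $ k) z
      - c $ left_col k $ right_col l' * c $ right_col l' $ left_col k
          * poly (mop_II N t a b k n (m - axis l' 1) $ k) z"
proof -
  have "\<forall>i. \<exists>P :: complex poly ^ 2.
    (\<forall>k h. h \<ge> n $ k - 1 \<longrightarrow> coeff (P $ k) h =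
       (if h = n $ k then if i = left_col k then 1 else 0
        else if h = n $ k - 1 then c $ i $ left_col k else 0)) \<and>
    (\<forall>l h. h \<le> m $ l \<longrightarrow> (h = m $ l \<longrightarrow> i \<noteq> right_col l) \<longrightarrow> pairing l P (monom 1 h) =
       - 2 * pi * \<i> * (if h = m $ l then c $ i $ right_col l
          else if Suc h = m $ l \<and> i = right_col l then 1 else 0))"
    by (intro allI RHP_row_pairings[OF pos(1) rhp])
  from choice[OF this] obtain P :: "4 \<Rightarrow> complex poly ^ 2" where
    P_coeff: "\<And>i k h. h \<ge> n $ k - 1 \<Longrightarrow> coeff (P i $ k) h =
       (if h = n $ k then if i = left_col k then 1 else 0
        else if h = n $ k - 1 then c $ i $ left_col k else 0)"
    and P_pairing: "\<And>i l h. h \<le> m $ l \<Longrightarrow> (h = m $ l \<longrightarrow> i \<noteq> right_col l) \<Longrightarrow> pairing l (P i) (monom 1 h) =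
       - 2 * pi * \<i> * (if h = m $ l then c $ i $ right_col l
          else if Suc h = m $ l \<and> i = right_col l then 1 else 0)"
    by blast
  have pred: "n $ k - 1 \<noteq> n $ k" "h \<ge> n $ k \<Longrightarrow> h \<noteq> n $ k - 1" for k h
    using pos(1)[rule_format, of k] by auto
  show ?thesis
  proof (rule nearest_neighbour_recurrence[OF pos nm kk' ll',
        where U = "\<lambda>k. P (left_col k)" and V = "\<lambda>l. P (right_col l)" and w = "- 2 * pi * \<i>"])
    fix k j i assume "i \<ge> n $ j"
    then show "coeff (P (left_col k) $ j) i = (if i = n $ j \<and> k = j then 1 else 0)"
      "coeff (P (right_col k) $ j) i = 0"
      using pred(2)[where k = j and h = i] by (simp_all add: P_coeff)
  next
    fix k j :: 2
    show "coeff (P (left_col k) $ j) (n $ j - 1) = c $ left_col k $ left_col j"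
      "coeff (P (right_col k) $ j) (n $ j - 1) = c $ right_col k $ left_col j"
      using pred(1)[of j] by (simp_all add: P_coeff)
    show "pairing j (P (left_col k)) (monom 1 (m $ j)) = - 2 * pi * \<i> * c $ left_col k $ right_col j"
      by (simp add: P_pairing)
  next
    fix k l :: 2 and i assume "i < m $ l"
    then show "pairing l (P (left_col k)) (monom 1 i) = 0"
      "pairing l (P (right_col k)) (monom 1 i) = (if k = l \<and> i = m $ l - 1 then - 2 * pi * \<i> else 0)"
      by (auto simp: P_pairing)
  qed auto
qed

end

theorem proposition1p7:
  fixes N t :: real and a b :: "real ^ 2" and n m :: "nat ^ 2"
    and Y :: "complex \<Rightarrow> complex ^ 4 ^ 4" and c :: "complex ^ 4 ^ 4"
  assumes "a $ 1 > a $ 2" and "b $ 1 > b $ 2" and "N > 0" and "0 < t" and "t < 1"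
    and "\<forall>k. n $ k > 0" and "\<forall>l. m $ l > 0" and "n $ 1 + n $ 2 = m $ 1 + m $ 2"
    and "is_RHP_solution N t a b n m Y c"
  shows "(\<forall>z.
      poly (mop_II N t a b 1 (n + 2 *s e\<^sub>1) (m + e\<^sub>1) $ 1) z =
        (z - of_real ((1 - t) * a $ 1) - of_real (t * b $ 1) + c $ 1 $ 2 * c $ 2 $ 3 / c $ 1 $ 3)
            * poly (mop_II N t a b 1 (n + e\<^sub>1) m $ 1) z
        - c $ 1 $ 2 * c $ 2 $ 1 * poly (mop_II N t a b 1 (n + e\<^sub>2) m $ 1) z
        - c $ 1 $ 3 * c $ 3 $ 1 * poly (mop_II N t a b 1 n (m - e\<^sub>1) $ 1) z
        - c $ 1 $ 4 * c $ 4 $ 1 * poly (mop_II N t a b 1 n (m - e\<^sub>2) $ 1) z) \<and>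
    (\<forall>z.
      poly (mop_II N t a b 1 (n + 2 *s e\<^sub>1) (m + e\<^sub>2) $ 1) z =
        (z - of_real ((1 - t) * a $ 1) - of_real (t * b $ 2) + c $ 1 $ 2 * c $ 2 $ 4 / c $ 1 $ 4)
            * poly (mop_II N t a b 1 (n + e\<^sub>1) m $ 1) z
        - c $ 1 $ 2 * c $ 2 $ 1 * poly (mop_II N t a b 1 (n + e\<^sub>2) m $ 1) z
        - c $ 1 $ 3 * c $ 3 $ 1 * poly (mop_II N t a b 1 n (m - e\<^sub>1) $ 1) z
        - c $ 1 $ 4 * c $ 4 $ 1 * poly (mop_II N t a b 1 n (m - e\<^sub>2) $ 1) z) \<and>
    (\<forall>z.
      poly (mop_II N t a b 2 (n + 2 *s e\<^sub>2) (m + e\<^sub>1) $ 2) z =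
        (z - of_real ((1 - t) * a $ 2) - of_real (t * b $ 1) + c $ 2 $ 1 * c $ 1 $ 3 / c $ 2 $ 3)
            * poly (mop_II N t a b 2 (n + e\<^sub>2) m $ 2) z
        - c $ 2 $ 1 * c $ 1 $ 2 * poly (mop_II N t a b 2 (n + e\<^sub>1) m $ 2) z
        - c $ 2 $ 3 * c $ 3 $ 2 * poly (mop_II N t a b 2 n (m - e\<^sub>1) $ 2) z
        - c $ 2 $ 4 * c $ 4 $ 2 * poly (mop_II N t a b 2 n (m - e\<^sub>2) $ 2) z) \<and>
    (\<forall>z.
      poly (mop_II N t a b 2 (n + 2 *s e\<^sub>2) (m + e\<^sub>2) $ 2) z =
        (z - of_real ((1 - t) * a $ 2) - of_real (t * b $ 2) + c $ 2 $ 1 * c $ 1 $ 4 / c $ 2 $ 4)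
            * poly (mop_II N t a b 2 (n + e\<^sub>2) m $ 2) z
        - c $ 2 $ 1 * c $ 1 $ 2 * poly (mop_II N t a b 2 (n + e\<^sub>1) m $ 2) z
        - c $ 2 $ 3 * c $ 3 $ 2 * poly (mop_II N t a b 2 n (m - e\<^sub>1) $ 2) z
        - c $ 2 $ 4 * c $ 4 $ 2 * poly (mop_II N t a b 2 n (m - e\<^sub>2) $ 2) z)"
proof -
  interpret gaussian_weights N t a b
    using assms by unfold_locales auto
  note rec = RHP_recurrence[OF assms(6-9)]
  have col: "left_col 1 = 1" "left_col 2 = 2" "right_col 1 = 3" "right_col 2 = 4"
    by (simp_all add: left_col_def right_col_def)
  have ne: "(1::2) \<noteq> 2" "(2::2) \<noteq> 1" by simp_all
  show ?thesis
    using rec[OF ne(1) ne(1)] rec[OF ne(1) ne(2)] rec[OF ne(2) ne(1)] rec[OF ne(2) ne(2)]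
    unfolding col center_def by (intro conjI allI) (simp_all add: algebra_simps)
qed

end
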